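(* Let $Y=X\beta+\epsilon$ with $p<n$, $\epsilon\sim\mathcal N_n(0,\sigma^2I_n)$, $\mu=X\beta$, and suppose $(X_i)_{1\le i\le p}$ is a linearly independent family and $J=\{j:\beta_j\ne0\}=\{1,\dots,k_0\}$ for some $k_0\le p$. Let $\alpha,\gamma\in]0,1[$. For each $1\le k<p$ let $\{\alpha_{k,t},t\in\mathcal T_k\}\subset]0,1[$ be chosen according to procedure P1 or P2 of the context, let $T_{k,\alpha}$ be the statistic defined in the context, and let $\hat k=\inf\{k\ge1: T_{k,\alpha}\le0\}$ (with $\hat k=p$ if $T_{k,\alpha}>0$ for all $1\le k<p$). Then, for all such $\mu\in\mathbb R^n$ and all $k_0\le p$, $$\mathbb P_\mu(\hat k>k_0)\le\alpha .$$ Moreover, if for every $1\le k\le k_0-1$ there exists $t\in\mathcal T_k$ such that $$\|\Pi_{S_{k,t}}(\mu)\|_n^2\ \ge\ C_1(k,t)\,\|\Pi_{V_{k,t}^\perp}(\mu)\|_n^2+\frac{\sigma^2}{n}\left[C_2(k,t)\sqrt{2^t\log\left(\frac{2k_0}{\alpha_{k,t}\gamma}\right)}+C_3(k,t)\log\left(\frac{2k_0}{\alpha_{k,t}\gamma}\right)\right],$$ then $$\mathbb P_\mu(\hat k<k_0)\le\gamma,\qquad\text{and hence}\qquad \mathbb P_\mu(\hat k\neq k_0)\le\gamma+\alpha .$$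
   Context: Model: $Y=X\beta+\epsilon$ where $Y\in\mathbb R^n$, $X=(X_1,\dots,X_p)$ is a deterministic $n\times p$ matrix with columns $X_i$, $\beta\in\mathbb R^p$ is unknown, $\epsilon\sim\mathcal N_n(0,\sigma^2I_n)$ with $\sigma>0$ unknown. $X_1$ is the vector all of whose coordinates equal $1/\sqrt n$, and $\|X_i\|_n=1$ for $2\le i\le p$. $\mu=E(Y)=X\beta$ and $\mathbb P_\mu$ is the law of $Y$. Notation: $\|s\|_n^2=\frac1n\sum_{i=1}^n s_i^2$; $\Pi_V$ is the orthogonal projector onto the subspace $V$; $\bar F_{D,N}(u)$ is the probability that a Fisher variable with $D$ and $N$ degrees of freedom exceeds $u$, and $\bar F^{-1}_{D,N}$ is its inverse; $\lfloor\cdot\rfloor$ is the integer part, $\log$ the natural logarithm and $\log_2$ the logarithm to base 2; $a\vee b=\max(a,b)$. For $1\le k<p$: $V_k=\mathrm{span}(X_1,\dots,X_k)$, $\mathcal T_k=\{0,1,\dots,\lfloor\log_2(p-k)\rfloor\}$, and for $t\in\mathcal T_k$: $S_{k,t}=\mathrm{span}(\Pi_{V_k^\perp}(X_{k+1}),\dots,\Pi_{V_k^\perp}(X_{k+2^t}))$, $V_{k,t}=V_k\oplus S_{k,t}$, $D_{k,t}=2^t$, $N_{k,t}=n-(k+2^t)$. Test statistic: $$T_{k,\alpha}=\sup_{t\in\mathcal T_k}\left\{\frac{N_{k,t}\|\Pi_{S_{k,t}}Y\|_n^2}{D_{k,t}\|Y-\Pi_{V_{k,t}}Y\|_n^2}-\bar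 F^{-1}_{D_{k,t},N_{k,t}}(\alpha_{k,t})\right\}.$$ Procedure P1: $\alpha_{k,t}=\alpha_{k,n}$ for all $t\in\mathcal T_k$, where $\alpha_{k,n}$ is the $\alpha$-quantile of the random variable $\inf_{t\in\mathcal T_k}\bar F_{D_{k,t},N_{k,t}}\left\{\frac{N_{k,t}\|\Pi_{S_{k,t}}\epsilon\|_n^2}{D_{k,t}\|\epsilon-\Pi_{V_{k,t}}\epsilon\|_n^2}\right\}$. Procedure P2: the numbers $\alpha_{k,t}\in]0,1[$ satisfy $\sum_{t\in\mathcal T_k}\alpha_{k,t}\le\alpha$. Constants: $L_t=\log(1/\alpha_{k,t})$, $L=\log(2/\gamma)$, $m_t=2\exp(4L_t/N_{k,t})$, and for $u>0$, $K_t(u)=1+2\sqrt{u/N_{k,t}}+2m_t\,u/N_{k,t}$; $$C_1(k,t)=2.5\,(1+K_t(L_t)\vee m_t)\,\frac{D_{k,t}+L_t}{N_{k,t}},$$ $$C_2(k,t)=2.5\sqrt{1+K_t^2(L)}\left(1+\sqrt{\frac{D_{k,t}}{N_{k,t}}}\right),$$ $$C_3(k,t)=2.5\left[\left(\frac{m_tK_t(L)}{2}\right)\vee5\right]\left(1+2\frac{D_{k,t}}{N_{k,t}}\right).$$ *)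

theory Defs
  imports "HOL-Probability.Probability"
begin

text \<open>
  The sample space is \<^typ>\<open>real ^ 'n\<close>, so n is \<open>CARD('n)\<close>.  A design matrix with p columns is
  represented by its columns \<open>X 1, \<dots>, X p\<close> (\<open>X :: nat \<Rightarrow> real ^ 'n\<close>; values of X outside
  \<open>{1..p}\<close> are irrelevant).  A collection of levels \<open>(\<alpha>\<^sub>k\<^sub>,\<^sub>t)\<close> is a function
  \<open>a :: nat \<Rightarrow> nat \<Rightarrow> real\<close>.
\<close>

section \<open>Geometry\<close>

definition norm_n :: "real ^ 'n \<Rightarrow> real" where
  "norm_n s = sqrt ((\<Sum>i\<in>UNIV. (s $ i)\<^sup>2) / real CARD('n))"

definition orth_proj :: "(real ^ 'n) set \<Rightarrow> real ^ 'n \<Rightarrow> real ^ 'n" where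
  "orth_proj V y = (THE v. v \<in> V \<and> y - v \<in> orthogonal_comp V)"

lemma orth_proj_unique:
  fixes V :: "(real ^ 'n) set"
  assumes V: "subspace V"
  shows "\<exists>!v. v \<in> V \<and> y - v \<in> orthogonal_comp V"
proof -
  have "y \<in> V + orthogonal_comp V"
    using subspace_sum_orthogonal_comp[OF V] by simp
  then obtain v w where vw: "v \<in> V" "w \<in> orthogonal_comp V" "y = v + w"
    by (auto elim: set_plus_elim)
  show ?thesis
  proof (rule ex1I[of _ v])
    show "v \<in> V \<and> y - v \<in> orthogonal_comp V"
      using vw by simp
    fix u assume u: "u \<in> V \<and> y - u \<in> orthogonal_comp V"
    have "v - u \<in> V"
      using V vw(1) u by (simp add: subspace_diff)
    moreover have "v - u = (y - u) - (y - v)"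
      by simp
    then have "v - u \<in> orthogonal_comp V"
      using u vw subspace_diff[OF subspace_orthogonal_comp, of "y - u" V "y - v"] by simp
    ultimately have "orthogonal (v - u) (v - u)"
      by (simp add: orthogonal_comp_def)
    then show "u = v"
      by (simp add: orthogonal_self)
  qed
qed

definition V_sp :: "(nat \<Rightarrow> real ^ 'n) \<Rightarrow> nat \<Rightarrow> (real ^ 'n) set" where
  "V_sp X k = span (X ` {1..k})"

definition T_set :: "nat \<Rightarrow> nat \<Rightarrow> nat set" where
  "T_set p k = {0..nat \<lfloor>log 2 (real p - real k)\<rfloor>}"

definition S_sp :: "(nat \<Rightarrow> real ^ 'n) \<Rightarrow> nat \<Rightarrow> nat \<Rightarrow> (real ^ 'n) set" where
  "S_sp X k t = span ((\<lambda>j. orth_proj (orthogonal_comp (V_sp X k)) (X j)) ` {k + 1..k + 2 ^ t})"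

text \<open>The sum of subspaces below is direct, as \<open>S_sp X k t\<close> is orthogonal to \<open>V_sp X k\<close>.\<close>

definition VS_sp :: "(nat \<Rightarrow> real ^ 'n) \<Rightarrow> nat \<Rightarrow> nat \<Rightarrow> (real ^ 'n) set" where
  "VS_sp X k t = V_sp X k + S_sp X k t"

definition D_df :: "nat \<Rightarrow> nat" where
  "D_df t = 2 ^ t"

text \<open>For \<open>p < n\<close>, \<open>1 \<le> k < p\<close> and \<open>t \<in> T_set p k\<close> this subtraction does not truncate and
  its result is positive.\<close>

definition N_df :: "nat \<Rightarrow> nat \<Rightarrow> nat \<Rightarrow> nat" where
  "N_df n k t = n - (k + 2 ^ t)"

section \<open>Distributions\<close>

text \<open>Density of \<open>N\<^sub>n(0, \<sigma>\<^sup>2 I\<^sub>n)\<close>; the second argument of \<^const>\<open>normal_density\<close> is the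
  standard deviation.\<close>

definition iso_normal_density :: "real \<Rightarrow> real ^ 'n \<Rightarrow> real" where
  "iso_normal_density \<sigma> x = (\<Prod>i\<in>UNIV. normal_density 0 \<sigma> (x $ i))"

definition chi_square :: "nat \<Rightarrow> real measure" where
  "chi_square d =
     distr (\<Pi>\<^sub>M i\<in>{..<d}. density lborel (\<lambda>x. ennreal (std_normal_density x))) borel
       (\<lambda>z. \<Sum>i<d. (z i)\<^sup>2)"

definition fisher :: "nat \<Rightarrow> nat \<Rightarrow> real measure" where
  "fisher D N =
     distr (chi_square D \<Otimes>\<^sub>M chi_square N) borel (\<lambda>(x, y). (x / real D) / (y / real N))"

definition Fbar :: "nat \<Rightarrow> nat \<Rightarrow> real \<Rightarrow> real" where
  "Fbar D N u = measure (fisher D N) {u<..}"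

text \<open>For \<open>D, N \<ge> 1\<close>, \<open>Fbar D N\<close> is a decreasing bijection from \<open>[0, \<infinity>[\<close> onto \<open>]0, 1]\<close>
  (it is constantly 1 on the negative half-line).\<close>

definition Fbar_inv :: "nat \<Rightarrow> nat \<Rightarrow> real \<Rightarrow> real" where
  "Fbar_inv D N = the_inv_into {0..} (Fbar D N)"

definition quantile :: "'a measure \<Rightarrow> ('a \<Rightarrow> real) \<Rightarrow> real \<Rightarrow> real" where
  "quantile M Z \<alpha> = Inf {x. \<alpha> \<le> measure M {\<omega> \<in> space M. Z \<omega> \<le> x}}"

section \<open>The testing procedure\<close>

definition F_stat :: "(nat \<Rightarrow> real ^ 'n) \<Rightarrow> nat \<Rightarrow> nat \<Rightarrow> real ^ 'n \<Rightarrow> real" where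
  "F_stat X k t y =
     (real (N_df CARD('n) k t) * (norm_n (orth_proj (S_sp X k t) y))\<^sup>2) /
     (real (D_df t) * (norm_n (y - orth_proj (VS_sp X k t) y))\<^sup>2)"

definition T_stat ::
    "(nat \<Rightarrow> real ^ 'n) \<Rightarrow> nat \<Rightarrow> (nat \<Rightarrow> nat \<Rightarrow> real) \<Rightarrow> nat \<Rightarrow> real ^ 'n \<Rightarrow> real" where
  "T_stat X p a k y =
     (SUP t\<in>T_set p k. F_stat X k t y - Fbar_inv (D_df t) (N_df CARD('n) k t) (a k t))"

definition k_hat ::
    "(nat \<Rightarrow> real ^ 'n) \<Rightarrow> nat \<Rightarrow> (nat \<Rightarrow> nat \<Rightarrow> real) \<Rightarrow> real ^ 'n \<Rightarrow> nat" where
  "k_hat X p a y =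
     (if \<forall>k. 1 \<le> k \<and> k < p \<longrightarrow> T_stat X p a k y > 0 then p
      else Inf {k. 1 \<le> k \<and> k < p \<and> T_stat X p a k y \<le> 0})"

definition procedure_P1 ::
    "'a measure \<Rightarrow> ('a \<Rightarrow> real ^ 'n) \<Rightarrow> (nat \<Rightarrow> real ^ 'n) \<Rightarrow> nat \<Rightarrow> real \<Rightarrow>
     (nat \<Rightarrow> nat \<Rightarrow> real) \<Rightarrow> nat \<Rightarrow> bool" where
  "procedure_P1 M \<epsilon> X p \<alpha> a k \<longleftrightarrow>
     (\<forall>t\<in>T_set p k. a k t =
        quantile M
          (\<lambda>\<omega>. INF s\<in>T_set p k. Fbar (D_df s) (N_df CARD('n) k s) (F_stat X k s (\<epsilon> \<omega>))) \<alpha>)"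

definition procedure_P2 :: "nat \<Rightarrow> real \<Rightarrow> (nat \<Rightarrow> nat \<Rightarrow> real) \<Rightarrow> nat \<Rightarrow> bool" where
  "procedure_P2 p \<alpha> a k \<longleftrightarrow> (\<Sum>t\<in>T_set p k. a k t) \<le> \<alpha>"

section \<open>Constants\<close>

text \<open>In this section \<open>a\<close> is the whole family of levels and \<open>n\<close> the sample size.\<close>

definition Lt :: "(nat \<Rightarrow> nat \<Rightarrow> real) \<Rightarrow> nat \<Rightarrow> nat \<Rightarrow> real" where
  "Lt a k t = ln (1 / a k t)"

definition L_of :: "real \<Rightarrow> real" where
  "L_of \<gamma> = ln (2 / \<gamma>)"

definition m_const :: "nat \<Rightarrow> (nat \<Rightarrow> nat \<Rightarrow> real) \<Rightarrow> nat \<Rightarrow> nat \<Rightarrow> real" where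
  "m_const n a k t = 2 * exp (4 * Lt a k t / real (N_df n k t))"

definition K_const :: "nat \<Rightarrow> (nat \<Rightarrow> nat \<Rightarrow> real) \<Rightarrow> nat \<Rightarrow> nat \<Rightarrow> real \<Rightarrow> real" where
  "K_const n a k t u =
     1 + 2 * sqrt (u / real (N_df n k t)) + 2 * m_const n a k t * u / real (N_df n k t)"

text \<open>In the first constant, the maximum binds more tightly than the sum:
  \<open>1 + K\<^sub>t(L\<^sub>t) \<or> m\<^sub>t\<close> is \<open>1 + max (K\<^sub>t(L\<^sub>t)) m\<^sub>t\<close>.\<close>

definition C1 :: "nat \<Rightarrow> (nat \<Rightarrow> nat \<Rightarrow> real) \<Rightarrow> nat \<Rightarrow> nat \<Rightarrow> real" where
  "C1 n a k t =
     2.5 * (1 + max (K_const n a k t (Lt a k t)) (m_const n a k t)) *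
     ((real (D_df t) + Lt a k t) / real (N_df n k t))"

definition C2 :: "nat \<Rightarrow> (nat \<Rightarrow> nat \<Rightarrow> real) \<Rightarrow> real \<Rightarrow> nat \<Rightarrow> nat \<Rightarrow> real" where
  "C2 n a \<gamma> k t =
     2.5 * sqrt (1 + (K_const n a k t (L_of \<gamma>))\<^sup>2) *
     (1 + sqrt (real (D_df t) / real (N_df n k t)))"

definition C3 :: "nat \<Rightarrow> (nat \<Rightarrow> nat \<Rightarrow> real) \<Rightarrow> real \<Rightarrow> nat \<Rightarrow> nat \<Rightarrow> real" where
  "C3 n a \<gamma> k t =
     2.5 * max (m_const n a k t * K_const n a k t (L_of \<gamma>) / 2) 5 *
     (1 + 2 * (real (D_df t) / real (N_df n k t)))"

end

theory Submission
  imports Defs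
begin

text \<open>
  If \<open>k_hat > k0\<close>, the test of the true hypothesis \<open>\<mu> \<in> V_sp X k0\<close> rejects; since \<open>\<mu>\<close> does not
  contribute to its statistic, this has probability at most \<open>\<alpha>\<close> by the choice of the levels.
  If \<open>k_hat < k0\<close>, one of the tests with index \<open>k < k0\<close> accepts, and each of them does so with
  probability at most \<open>\<gamma> / k0\<close>.

  In an orthonormal basis adapted to \<open>S_sp X k t\<close> and the orthogonal complement of
  \<open>VS_sp X k t\<close>, the Fisher statistic is a ratio of two independent, possibly noncentral,
  chi-square variables \<open>A\<close> and \<open>B\<close>, and acceptance means \<open>A \<le> q B\<close>. The constants of the theorem
  involve \<open>K_const\<close> at \<open>ln (2 / \<gamma>)\<close>, whereas separate deviation inequalities for \<open>A\<close> and \<open>B\<close> at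
  level \<open>\<gamma> / k0\<close> would lead to \<open>ln (2 k0 / \<gamma>)\<close>. Instead, the exponential moment of \<open>s (q B - A)\<close> is
  computed exactly. The critical value \<open>q\<close> is controlled in the same way, by the exponential
  moments of \<open>s (A - q B)\<close> in the central case.
\<close>

section \<open>The inequality between the critical value and the signal\<close>

text \<open>The critical value has no closed form; it is known only through its level, so all that
  is used about it are the inequalities that the level imposes, one for each Chernoff parameter.
  Dividing by the residual degrees of freedom N leaves the scalars d = D / N, x = L_t / N and y = ln
  (2 k0 / \<gamma>) / N together with the normalised noncentralities, and the power statement
  becomes the existence of one parameter w satisfying \<open>power_bound\<close>. The obstacle is
  the term d ln (1 + w) + ln (1 - w q), whose first order part w (d - q) would have to be paid for
  by the signal if q were bounded separately. The level inequality at the same w has the opposite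
  first order part w (q - d), so adding the two leaves only second order terms. This requires w q to
  stay well below 1, with good control of its square. Once x is not small, q grows with exp (2 x),
  and the cruder requirement ln (1 - w q) \<ge> - 2 x is both attainable and sufficient.\<close>

lemma ln_ge_pade:
  fixes v :: real
  assumes "1 \<le> v"
  shows "2 * (v - 1) / (v + 1) \<le> ln v"
proof -
  let ?f = "\<lambda>v::real. ln v - 2 * (v - 1) / (v + 1)"
  have "?f 1 \<le> ?f v"
  proof (rule DERIV_nonneg_imp_nondecreasing[OF assms])
    fix s :: real assume s: "1 \<le> s" "s \<le> v"
    have "(?f has_real_derivative (1 / s - 4 / (s + 1)\<^sup>2)) (at s)"
      using s by (auto intro!: derivative_eq_intros simp: field_simps power2_eq_square)
    \<comment> \<open>The difference is (s - 1)^2 / (s (s + 1)^2).\<close>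
    moreover have "0 \<le> 1 / s - 4 / (s + 1)\<^sup>2"
      using s zero_le_power2[of "s - 1"] by (simp add: field_simps power2_eq_square)
    ultimately show "\<exists>y. (?f has_real_derivative y) (at s) \<and> 0 \<le> y" by blast
  qed
  then show ?thesis by simp
qed

text \<open>The map t |-> (2 + t) / (2 - t) inverts v |-> 2 (v - 1) / (v + 1), so this is
  \<open>ln_ge_pade\<close> solved for the exponential. Being exact to second order, it keeps later
  estimates rational at little loss.\<close>

lemma exp_le_pade:
  fixes t :: real
  assumes "0 \<le> t" "t < 2"
  shows "exp t \<le> (2 + t) / (2 - t)"
proof -
  define v where "v = (2 + t) / (2 - t)"
  have v: "1 \<le> v" using assms by (simp add: v_def)
  have "v + 1 = 4 / (2 - t)" "v - 1 = 2 * t / (2 - t)"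
    using assms by (simp_all add: v_def field_simps)
  then have "2 * (v - 1) / (v + 1) = t" using assms by simp
  then have "t \<le> ln v" using ln_ge_pade[OF v] by simp
  then show ?thesis using v by (simp add: ln_ge_iff v_def)
qed

lemma neg_ln_one_minus_le:
  fixes w :: real
  assumes "w < 1"
  shows "- ln (1 - w) \<le> w / (1 - w)"
proof -
  have "ln (1 / (1 - w)) \<le> 1 / (1 - w) - 1"
    using assms by (intro ln_le_minus_one) simp
  then show ?thesis using assms by (simp add: ln_div field_simps)
qed

text \<open>
  Here \<open>d = D / N\<close>, \<open>x = L\<^sub>t / N\<close>, and \<open>q\<close> is \<open>D / N\<close> times the critical value of the Fisher test.
  The inequality \<open>critical\<close> is the Chernoff bound, with parameter \<open>w / 2\<close>, for the level of that test.
\<close>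

locale critical_value =
  fixes d x q :: real
  assumes d: "0 < d" and x: "0 < x" and q: "0 \<le> q"
    and critical: "\<And>w. 0 < w \<Longrightarrow> w < 1 \<Longrightarrow> ln (1 + w * q) + d * ln (1 - w) \<le> 2 * x"
begin

definition v where "v = exp (2 * x)"

lemma v_gt_1: "1 < v"
  using x by (simp add: v_def)

lemma exp_4x: "exp (4 * x) = v\<^sup>2"
  by (simp add: v_def power2_eq_square flip: exp_add)

text \<open>The rational bound for ln v = 2 x; it converts the excess of v over 1 into a multiple of
  x, the scale on which the hypotheses are stated.\<close>

lemma v_minus_1_le: "v - 1 \<le> x * (v + 1)"
proof -
  have "2 * (v - 1) / (v + 1) \<le> 2 * x"
    using ln_ge_pade[of v] v_gt_1 by (simp add: v_def)
  then show ?thesis using v_gt_1 by (simp add: divide_le_eq)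
qed

text \<open>Exponentiating \<open>critical\<close> after replacing - ln (1 - w) by w / (1 - w). The
  upper bound \<open>t\<close> is left free so that each application can choose an exponent that is
  easy to estimate.\<close>

lemma q_bound:
  assumes w: "0 < w" "w < 1" and t: "d * (w / (1 - w)) \<le> t"
  shows "w * q \<le> v * exp t - 1"
proof -
  have "d * - ln (1 - w) \<le> d * (w / (1 - w))"
    using neg_ln_one_minus_le[of w] w d by (intro mult_left_mono) auto
  then have "ln (1 + w * q) \<le> 2 * x + t"
    using critical[OF w] t by simp
  moreover have "0 < 1 + w * q" using w q by (simp add: add_pos_nonneg)
  ultimately have "1 + w * q \<le> exp (2 * x + t)"
    by (metis exp_le_cancel_iff exp_ln)
  then show ?thesis by (simp add: v_def exp_add)
qed

lemma q_le: "q \<le> d * (4 * v - 2) + 2 * (v - 1)"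
proof -
  \<comment> \<open>For this w the exponent is d / (1 + 2 d) < 1 / 2. Hence exp t \<le> 1 / (1 - t)
    is affordable, and its denominator 1 + d cancels against the factor 2 (1 + d) = 1 / w.\<close>
  let ?w = "1 / (2 * (1 + d))" and ?t = "d / (1 + 2 * d)"
  have w: "0 < ?w" "?w < 1" using d by auto
  have eq: "?w / (1 - ?w) = 1 / (1 + 2 * d)" using d by (simp add: field_simps)
  have "?w * q \<le> v * exp ?t - 1"
    by (rule q_bound[OF w]) (unfold eq, simp)
  also have "exp ?t \<le> (1 + 2 * d) / (1 + d)"
  proof -
    have "1 - ?t \<le> exp (- ?t)" using exp_ge_add_one_self[of "- ?t"] by simp
    moreover have "1 - ?t = (1 + d) / (1 + 2 * d)" using d by (simp add: field_simps)
    ultimately show ?thesis using d by (simp add: exp_minus field_simps)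
  qed
  then have "v * exp ?t - 1 \<le> v * ((1 + 2 * d) / (1 + d)) - 1"
    using v_gt_1 by (intro diff_right_mono mult_left_mono) auto
  finally have "q \<le> 2 * (1 + d) * (v * ((1 + 2 * d) / (1 + d)) - 1)"
    using d by (simp add: field_simps)
  also have "\<dots> = d * (4 * v - 2) + 2 * (v - 1)" using d by (simp add: field_simps)
  finally show ?thesis .
qed

lemma q_le_x: "q \<le> d * (4 * v - 2) + 2 * (v + 1) * x"
  using q_le v_minus_1_le by (simp add: algebra_simps)

text \<open>
  The last inequality says that the Chernoff bound with parameter \<open>w / 2\<close> for a noncentral numerator
  with noncentrality \<open>N l\<close> is at most \<open>exp (- N y)\<close>; the one before it makes the noncentrality of the
  denominator harmless.
\<close>

definition power_bound where
  "power_bound l y w \<longleftrightarrow> 0 < w \<and> w < 1 \<and> w * q < 1 \<and>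
     (1 + w) * q \<le> 2.5 * (1 + 2 * v\<^sup>2) * (d + x) * (1 - w * q) \<and>
     2 * y \<le> d * ln (1 + w) + l * w / (1 + w) + ln (1 - w * q)"

text \<open>Squaring the rational bound at 1 / 4 is sharper than using it at 1 / 2: the value 5 / 3
  obtained there would be too large for the estimate at v = 1.3 in the next lemma.\<close>

lemma exp_half_le: "exp (1 / 2 :: real) \<le> 1.654"
proof -
  have "exp (1 / 4 :: real) \<le> 9 / 7"
    using exp_le_pade[of "1 / 4"] by simp
  then have "(exp (1 / 4 :: real))\<^sup>2 \<le> (9 / 7)\<^sup>2" by (intro power_mono) auto
  then show ?thesis by (simp add: power2_eq_square flip: exp_add)
qed

text \<open>
  For large \<open>x\<close>, a choice of \<open>w\<close> that does not depend on \<open>y\<close> gives both \<open>l w / (1 + w) \<ge> 2 (x + y)\<close>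
  and \<open>1 - w q \<ge> exp (- 2 x)\<close>.
\<close>

lemma large_x_bound:
  assumes v: "1.3 \<le> v" and y: "0 \<le> y"
    and l: "2.5 * max (v\<^sup>2) 5 * (1 + 2 * d) * (x + y) \<le> l"
  shows "\<exists>w. power_bound l y w"
proof -
  define E where "E = max (v\<^sup>2) 5"
  have E: "5 \<le> E" "v\<^sup>2 \<le> E" by (auto simp: E_def)
  \<comment> \<open>The reciprocal of the factor of 2.5 (x + y) in the lower bound for
    \<open>l\<close>, so that l w \<ge> 2.5 (x + y). As w \<le> 0.2, division by 1 + w still leaves
    2 (x + y).\<close>
  define w where "w = 1 / (E * (1 + 2 * d))"
  have w0: "0 < w" using E d by (simp add: w_def)
  have "5 * 1 \<le> E * (1 + 2 * d)" using E d by (intro mult_mono) auto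
  then have w1: "w \<le> 0.2" unfolding w_def by (simp add: field_simps)
  define b where "b = w * q"
  \<comment> \<open>\<open>q_bound\<close> is applied at E w = 1 / (1 + 2 d) rather than at w: there
    the exponent is exactly 1 / 2, independent of d.\<close>
  have "1 / (1 + 2 * d) * q \<le> v * exp (1 / 2) - 1"
  proof (rule q_bound)
    have "1 / (1 + 2 * d) / (1 - 1 / (1 + 2 * d)) = 1 / (2 * d)"
      using d by (simp add: field_simps)
    then show "d * (1 / (1 + 2 * d) / (1 - 1 / (1 + 2 * d))) \<le> 1 / 2"
      using d by simp
  qed (use d in auto)
  also have "\<dots> \<le> v * 1.654 - 1" using v exp_half_le by (intro diff_right_mono mult_left_mono) auto
  also have "1 / (1 + 2 * d) * q = b * E"
    unfolding b_def w_def using E d by simp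
  finally have "b * E \<le> v * 1.654 - 1" .
  moreover have "v * 1.654 - 1 \<le> (1 - 1 / v) * E"
  \<comment> \<open>The goal is w q \<le> 1 - 1 / v. The two bounds for \<open>E\<close> are used
    one at a time, and 2.25 is just above sqrt 5, where v^2 overtakes 5.\<close>
  proof (cases "v \<le> 2.25")
    case True
    have "0 \<le> (v - 1.3) * (2.25 - v)" using True v by simp
    then have "0 \<le> 1.654 * ((v - 1.3) * (2.25 - v))" by simp
    then have "v * (v * 1.654 - 1) \<le> (v - 1) * 5" using v by (simp add: algebra_simps)
    also have "\<dots> \<le> (v - 1) * E" using v E by (intro mult_left_mono) auto
    finally show ?thesis using v by (simp add: field_simps)
  next
    case False
    then have "0 \<le> (v - 2.25) * (v - 0.41)" by simp
    also have "\<dots> = v * v - 2.66 * v + 0.9225" by (simp add: field_simps)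
    finally have "v * 1.654 - 1 \<le> v * v - v" using v by simp
    also have "\<dots> = (v - 1) * v" by (simp add: algebra_simps)
    finally have "v * 1.654 - 1 \<le> (v - 1) * v" .
    also have "\<dots> = (1 - 1 / v) * v\<^sup>2" using v by (simp add: field_simps power2_eq_square)
    also have "\<dots> \<le> (1 - 1 / v) * E" using v E by (intro mult_left_mono) auto
    finally show ?thesis .
  qed
  ultimately have "b * E \<le> (1 - 1 / v) * E" by simp
  then have b: "1 / v \<le> 1 - b" using E mult_right_le_imp_le[of b E "1 - 1 / v"] by simp
  have b1: "0 < 1 - b" using b v by (smt (verit) divide_pos_pos)
  have "(1 + w) * q \<le> 1.2 * (d * (4 * v - 2) + 2 * (v + 1) * x)"
    using w0 w1 q q_le_x by (intro mult_mono) auto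
  \<comment> \<open>Replacing 1 - b by its lower bound 1 / v costs a factor v, but 2.5 (1 + 2 v^2) /
    v \<ge> 5 v still dominates the linear growth in v of the bound for q.\<close>
  also have "\<dots> \<le> 2.5 * (1 + 2 * v\<^sup>2) * (d + x) * (1 / v)"
  proof -
    have "2.5 * (1 + 2 * v\<^sup>2) * (1 / v) = 5 * v + 2.5 / v"
      using v by (simp add: field_simps power2_eq_square)
    moreover have "0 < 2.5 / v" using v by simp
    ultimately have k: "5 * v \<le> 2.5 * (1 + 2 * v\<^sup>2) * (1 / v)" by simp
    have "1.2 * (d * (4 * v - 2) + 2 * (v + 1) * x) = d * (1.2 * (4 * v - 2)) + x * (2.4 * (v + 1))"
      by (simp add: algebra_simps)
    also have "\<dots> \<le> d * (5 * v) + x * (5 * v)"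
      using d x v by (intro add_mono mult_left_mono) auto
    also have "\<dots> = (d + x) * (5 * v)" by (simp add: algebra_simps)
    also have "\<dots> \<le> (d + x) * (2.5 * (1 + 2 * v\<^sup>2) * (1 / v))"
      using d x k by (intro mult_left_mono) auto
    also have "\<dots> = 2.5 * (1 + 2 * v\<^sup>2) * (d + x) * (1 / v)" by simp
    finally show ?thesis .
  qed
  also have "\<dots> \<le> 2.5 * (1 + 2 * v\<^sup>2) * (d + x) * (1 - b)"
    using b d x by (intro mult_left_mono) auto
  finally have rho: "(1 + w) * q \<le> 2.5 * (1 + 2 * v\<^sup>2) * (d + x) * (1 - b)" .
  have "2 * (x + y) \<le> 2.5 * (x + y) / (1 + w)"
  proof -
    have "(x + y) * (2 * (1 + w)) \<le> (x + y) * 2.5"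
      using w1 x y by (intro mult_left_mono) auto
    then have "2 * (x + y) * (1 + w) \<le> 2.5 * (x + y)" by (simp add: algebra_simps)
    then show ?thesis using w0 by (subst pos_le_divide_eq) auto
  qed
  also have "2.5 * (x + y) = 2.5 * E * (1 + 2 * d) * (x + y) * w"
  proof -
    have "E * (1 + 2 * d) * w = 1" using E d by (simp add: w_def)
    moreover have "2.5 * E * c * z * w = 2.5 * z * (E * c * w)" for c z :: real by simp
    ultimately show ?thesis by (simp only: mult_1_right)
  qed
  also have "\<dots> / (1 + w) \<le> l * w / (1 + w)"
    using l w0 by (intro divide_right_mono mult_right_mono) (auto simp: E_def)
  finally have 1: "2 * (x + y) \<le> l * w / (1 + w)" .
  have "ln (1 / v) \<le> ln (1 - b)" using b b1 v by (subst ln_le_cancel_iff) auto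
  then have 2: "- 2 * x \<le> ln (1 - b)" using v by (simp add: ln_div v_def)
  have 3: "0 \<le> d * ln (1 + w)" using d w0 by simp
  have "power_bound l y w"
    unfolding power_bound_def using w0 w1 b1 rho 1 2 3 by (auto simp: b_def)
  then show ?thesis ..
qed

text \<open>
  For small \<open>x\<close>, \<open>critical\<close> is applied with the same \<open>w\<close> as the power bound:
  \<open>ln (1 - w q) = ln (1 - (w q)\<^sup>2) - ln (1 + w q)\<close> then costs only \<open>2 x\<close> and second order terms.
  With \<open>w\<close> of order \<open>u / l\<close>, these are quadratic in the shares \<open>p\<close> and \<open>\<theta>\<close> of the linear and
  the square root part of \<open>l\<close>.
\<close>

lemma small_x_bound:
  assumes v: "v < 1.3" and y: "0 \<le> y"
    and l: "2.5 * sqrt 2 * (1 + sqrt d) * sqrt (d * (x + y)) + 2.5 * 5 * (1 + 2 * d) * (x + y) \<le> l"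
  shows "\<exists>w. power_bound l y w"
proof -
  define u where "u = x + y"
  have u: "0 < u" "x \<le> u" using x y by (auto simp: u_def)
  define r where "r = sqrt u"
  have r: "0 < r" "r\<^sup>2 = u" using u by (auto simp: r_def)
  define g where "g = sqrt (d * (1 + d))"
  have g: "0 < g" "g\<^sup>2 = d * (1 + d)" using d by (auto simp: g_def)
  \<comment> \<open>The two parts of the lower bound for \<open>l\<close> are at least 25 / 6 P and
    5 Q, where 1.4 = 2 * 0.7 stands for sqrt 2 and g \<le> sqrt d (1 + sqrt d). The scalings are
    chosen for the identities w (1 + 2 d) = p / 3, which keeps w and w q away from 1, and 0.7 w g =
    \<theta> r, which makes w^2 g^2 of order \<theta>^2 u.\<close>
  define P where "P = 3 * (1 + 2 * d) * u"
  define Q where "Q = 0.7 * g * r"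
  have PQ: "0 < P" "0 < Q" using d u g r by (auto simp: P_def Q_def)
  define w where "w = u / (P + Q)"
  define p where "p = P / (P + Q)"
  define \<theta> where "\<theta> = Q / (P + Q)"
  have p01: "0 < p" "p < 1" and \<theta>: "\<theta> = 1 - p" "0 < \<theta>"
    using PQ by (auto simp: p_def \<theta>_def field_simps)
  have wd: "w * (1 + 2 * d) = p / 3"
  proof -
    have "w * (1 + 2 * d) = u * (1 + 2 * d) / (P + Q)" by (simp add: w_def)
    also have "u * (1 + 2 * d) = P / 3" by (simp add: P_def)
    finally show ?thesis by (simp add: p_def)
  qed
  have wg: "0.7 * w * g = \<theta> * r"
    using PQ r(2) by (simp add: w_def \<theta>_def Q_def power2_eq_square field_simps)
  have w0: "0 < w" using u PQ by (simp add: w_def)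
  have "w * 1 \<le> w * (1 + 2 * d)" using w0 d by (intro mult_left_mono) auto
  then have wp: "w \<le> p / 3" using wd by simp
  have w1: "w < 1" using wp p01 by simp
  define b where "b = w * q"
  have b0: "0 \<le> b" using w0 q by (simp add: b_def)

  \<comment> \<open>The bound for b obtained from \<open>q_bound\<close> at 2 / (5 (1 + 2 d)), split
    into its value \<open>b1\<close> at v = 1 and a multiple \<open>b2\<close> of v - 1. The former
    will be measured against \<theta> r, the latter against p r.\<close>
  define b1 where "b1 = 5 * d * (1 + 2 * d) * w / (3 + 9 * d)"
  define b2 where "b2 = 55 / 18 * (1 + 2 * d) * w * (v - 1)"
  have "b \<le> b1 + b2"
  proof -
    let ?w = "2 / (5 * (1 + 2 * d))" and ?t = "2 * d / (3 + 10 * d)"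
    have ww: "0 < ?w" "?w < 1" using d by auto
    have "2 / c / (1 - 2 / c) = 2 / (c - 2)" if "2 < c" for c :: real
      using that by (simp add: field_simps)
    from this[of "5 * (1 + 2 * d)"] have eq: "?w / (1 - ?w) = 2 / (3 + 10 * d)"
      using d by (simp add: algebra_simps)
    have t: "0 \<le> ?t" "?t < 2" using d by (simp_all add: divide_less_eq)
    have "?w * q \<le> v * exp ?t - 1"
      by (rule q_bound[OF ww]) (unfold eq, simp add: mult.commute)
    also have "\<dots> \<le> v * ((3 + 11 * d) / (3 + 9 * d)) - 1"
    proof -
      have aux: "2 * a / c / (2 * b / c) = a / b" if "0 < c" for a b c :: real
        using that by simp
      have "exp ?t \<le> (2 + ?t) / (2 - ?t)" by (rule exp_le_pade[OF t])
      also have "2 + ?t = 2 * (3 + 11 * d) / (3 + 10 * d)" using d by (simp add: add_divide_eq_iff)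
      also have "2 - ?t = 2 * (3 + 9 * d) / (3 + 10 * d)" using d by (simp add: diff_divide_eq_iff)
      also have "2 * (3 + 11 * d) / (3 + 10 * d) / (2 * (3 + 9 * d) / (3 + 10 * d))
          = (3 + 11 * d) / (3 + 9 * d)"
        by (rule aux) (use d in simp)
      finally show ?thesis using v_gt_1 by (intro diff_right_mono mult_left_mono) auto
    qed
    also have "\<dots> = (v - 1) * ((3 + 11 * d) / (3 + 9 * d)) + 2 * d / (3 + 9 * d)"
    proof -
      have "(3 + 11 * d) / (3 + 9 * d) = 1 + 2 * d / (3 + 9 * d)"
        using d by (simp add: add_divide_eq_iff)
      moreover have "v * (1 + c) - 1 = (v - 1) * (1 + c) + c" for c by (simp add: algebra_simps)
      ultimately show ?thesis by (simp only:)
    qed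
    also have "\<dots> \<le> (v - 1) * (11 / 9) + 2 * d / (3 + 9 * d)"
      using v_gt_1 d by (intro add_right_mono mult_left_mono) (auto simp: divide_le_eq)
    finally have *: "?w * q \<le> (v - 1) * (11 / 9) + 2 * d / (3 + 9 * d)" .
    have "b = 5 / 2 * (1 + 2 * d) * w * (?w * q)"
      using d by (simp add: b_def del: distrib_left_numeral)
    also have "\<dots> \<le> 5 / 2 * (1 + 2 * d) * w * ((v - 1) * (11 / 9) + 2 * d / (3 + 9 * d))"
      using * d w0 by (intro mult_left_mono) auto
    also have "\<dots> = b1 + b2"
    proof -
      have "5 / 2 * a * w * (z * (11 / 9) + 2 * d / c) = 5 * d * a * w / c + 55 / 18 * a * w * z"
        for a z c :: real by (simp add: algebra_simps)
      then show ?thesis by (simp only: b1_def b2_def)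
    qed
    finally show ?thesis .
  qed
  have b1: "0 \<le> b1" and b2: "0 \<le> b2" using d w0 v_gt_1 by (auto simp: b1_def b2_def)

  have "b1\<^sup>2 + d * w\<^sup>2 \<le> 1.3 * (w\<^sup>2 * g\<^sup>2)"
  proof -
    have *: "25 * d * (1 + 2 * d)\<^sup>2 + (3 + 9 * d)\<^sup>2 \<le> 1.3 * (1 + d) * (3 + 9 * d)\<^sup>2"
    proof -
      \<comment> \<open>Ten times the difference of the two sides is 27 + 29 d - 55 d^2 + 53 d^3;
        this square absorbs the negative term, at the price of 3025 / 212 < 29 in the linear
        coefficient.\<close>
      have "0 \<le> 53 * (d * (d - 55 / 106)\<^sup>2)" using d by simp
      also have "\<dots> = 53 * (d * d * d) - 55 * (d * d) + 3025 / 212 * d"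
        by (simp add: power2_eq_square field_simps)
      finally have "9 + 79 * d + 181 * (d * d) + 100 * (d * d * d)
          \<le> 11.7 + 81.9 * d + 175.5 * (d * d) + 105.3 * (d * d * d)"
        using d by (simp add: field_simps)
      then show ?thesis by (simp add: power2_eq_square field_simps)
    qed
    have "(b1\<^sup>2 + d * w\<^sup>2) * (3 + 9 * d)\<^sup>2
        = w\<^sup>2 * d * (25 * d * (1 + 2 * d)\<^sup>2 + (3 + 9 * d)\<^sup>2)"
    proof -
      have "b1 * (3 + 9 * d) = 5 * d * (1 + 2 * d) * w" using d by (simp add: b1_def)
      then have "b1\<^sup>2 * (3 + 9 * d)\<^sup>2 = (5 * d * (1 + 2 * d) * w)\<^sup>2"
        by (metis power_mult_distrib)
      then show ?thesis by (simp add: power2_eq_square algebra_simps)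
    qed
    also have "\<dots> \<le> w\<^sup>2 * d * (1.3 * (1 + d) * (3 + 9 * d)\<^sup>2)"
      using * d by (intro mult_left_mono) auto
    also have "\<dots> = 1.3 * (w\<^sup>2 * g\<^sup>2) * (3 + 9 * d)\<^sup>2" using g by simp
    finally show ?thesis by (rule mult_right_le_imp_le) (use d in \<open>simp add: zero_less_power\<close>)
  qed
  also have "w\<^sup>2 * g\<^sup>2 = (\<theta> * r)\<^sup>2 / 0.49"
    by (simp flip: wg add: power2_eq_square)
  also have "1.3 * ((\<theta> * r)\<^sup>2 / 0.49) \<le> (1.63 * \<theta> * r)\<^sup>2"
  proof -
    have "1.3 * (z\<^sup>2 / 0.49) \<le> (1.63 * z)\<^sup>2" for z :: real
      by (simp add: power_mult_distrib power_divide)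
    from this[of "\<theta> * r"] show ?thesis by (simp add: mult.assoc)
  qed
  finally have b1w: "b1\<^sup>2 + d * w\<^sup>2 \<le> (1.63 * \<theta> * r)\<^sup>2" .
  have "b1\<^sup>2 \<le> (1.63 * \<theta> * r)\<^sup>2"
  proof -
    have "0 \<le> d * w\<^sup>2" using d by simp
    with b1w show ?thesis by linarith
  qed
  then have b1r: "b1 \<le> 1.63 * \<theta> * r"
    by (rule power2_le_imp_le) (use \<theta>(2) r(1) in simp)
  have b2p: "b2 = 55 / 54 * p * (v - 1)"
  proof -
    have "b2 = 55 / 18 * (w * (1 + 2 * d)) * (v - 1)" by (simp add: b2_def)
    then show ?thesis unfolding wd by simp
  qed
  \<comment> \<open>One factor v - 1 is bounded by 0.3 and the other by 2.3 u, so that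
    \<open>b2\<close>, like \<open>b1\<close>, is of order sqrt u.\<close>
  have "(v - 1)\<^sup>2 \<le> 0.3 * (2.3 * u)"
  proof -
    have "x * (v + 1) \<le> u * 2.3" using u x v v_gt_1 by (intro mult_mono) auto
    then have *: "v - 1 \<le> 2.3 * u" using v_minus_1_le by simp
    have "(v - 1) * (v - 1) \<le> 0.3 * (2.3 * u)"
      using * v v_gt_1 by (intro mult_mono) auto
    then show ?thesis by (simp add: power2_eq_square)
  qed
  then have "(55 / 54 * p)\<^sup>2 * (v - 1)\<^sup>2 \<le> (55 / 54 * p)\<^sup>2 * (0.3 * (2.3 * u))"
    by (intro mult_left_mono) auto
  also have "\<dots> \<le> (0.85 * p)\<^sup>2 * u" using u p01 by (simp add: power2_eq_square)
  finally have "b2\<^sup>2 \<le> (0.85 * p * r)\<^sup>2"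
    unfolding b2p by (simp only: power_mult_distrib r(2))
  then have b2r: "b2 \<le> 0.85 * p * r"
    by (rule power2_le_imp_le) (use p01 r(1) in simp)
  have "b\<^sup>2 \<le> (b1 + b2)\<^sup>2" using \<open>b \<le> b1 + b2\<close> b0 by (intro power_mono) auto
  also have "(b1 + b2)\<^sup>2 = (b1\<^sup>2 + d * w\<^sup>2) + 2 * (b1 * b2) + b2\<^sup>2 - d * w\<^sup>2"
    by (simp add: power2_eq_square algebra_simps)
  also have "\<dots> \<le> (1.63 * \<theta> * r)\<^sup>2 + 2 * ((1.63 * \<theta> * r) * (0.85 * p * r)) + (0.85 * p * r)\<^sup>2 - d * w\<^sup>2"
    using b1w b1r b2r b1 b2 \<open>b2\<^sup>2 \<le> (0.85 * p * r)\<^sup>2\<close> \<theta>(2) r(1)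
    by (intro diff_right_mono add_mono mult_left_mono mult_mono) simp_all
  also have "\<dots> = (1.63 * \<theta> + 0.85 * p)\<^sup>2 * r\<^sup>2 - d * w\<^sup>2"
    by (simp add: power2_eq_square algebra_simps)
  also note r(2)
  finally have bw: "b\<^sup>2 + d * w\<^sup>2 \<le> (1.63 * \<theta> + 0.85 * p)\<^sup>2 * u" by simp

  \<comment> \<open>A common bound for b^2 and w^2, which turns both logarithms into linear terms
    with denominator 1 - s. It comes from b \<le> (5 / 27 + 0.3 * 55 / 54) p < 0.4909 p.\<close>
  define s where "s = 0.245 * p\<^sup>2"
  have "p\<^sup>2 < 1" using p01 by (simp add: power_less_one_iff)
  then have s: "0 < s" "s < 0.245" using p01 by (auto simp: s_def)
  have "b \<le> 0.4909 * p"
  proof -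
    have "b1 = w * (1 + 2 * d) * (5 * d / (3 + 9 * d))" by (simp add: b1_def)
    also have "\<dots> \<le> p / 3 * (5 / 9)"
      unfolding wd using p01 d by (intro mult_left_mono) (auto simp: field_simps)
    finally have "b1 \<le> 5 / 27 * p" by simp
    moreover have "b2 \<le> 55 / 54 * p * 0.3"
      unfolding b2p using p01 v by (intro mult_left_mono) auto
    ultimately show ?thesis using \<open>b \<le> b1 + b2\<close> p01 by simp
  qed
  then have "b\<^sup>2 \<le> (0.4909 * p)\<^sup>2" using b0 by (intro power_mono) auto
  also have "\<dots> \<le> s" by (simp add: s_def power2_eq_square)
  finally have bs: "b\<^sup>2 \<le> s" .
  have "w\<^sup>2 \<le> (p / 3)\<^sup>2" using w0 wp by (intro power_mono) auto
  also have "\<dots> \<le> s" by (simp add: s_def power2_eq_square)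
  finally have ws: "w\<^sup>2 \<le> s" .
  have b_lt: "b < 1" using \<open>b \<le> 0.4909 * p\<close> p01 by simp

  have ln_s: "- ln (1 - z) \<le> z / (1 - s)" if "z \<le> s" "0 \<le> z" for z
  proof -
    have "- ln (1 - z) \<le> z / (1 - z)" using that s by (intro neg_ln_one_minus_le) auto
    also have "\<dots> \<le> z / (1 - s)" using that s by (intro divide_left_mono) auto
    finally show ?thesis .
  qed
  have lw: "u * (5 * \<theta> + 25 / 6 * p) \<le> l * w"
  proof -
    have "g \<le> sqrt d * (1 + sqrt d)"
      unfolding g_def using d
      by (intro real_le_lsqrt) (auto simp: power2_eq_square algebra_simps)
    moreover have "1.4 \<le> sqrt 2" by (rule real_le_rsqrt) (simp add: power2_eq_square)
    ultimately have "1.4 * (g * r) \<le> sqrt 2 * ((sqrt d * (1 + sqrt d)) * r)"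
      using g(1) r(1) d by (intro mult_mono) auto
    also have "\<dots> = sqrt 2 * (1 + sqrt d) * sqrt (d * u)"
      by (simp add: r_def real_sqrt_mult)
    finally have "1.4 * (g * r) \<le> sqrt 2 * (1 + sqrt d) * sqrt (d * u)" .
    have "5 * Q + 25 / 6 * P \<le> l"
    proof -
      have "5 * Q = 2.5 * (1.4 * (g * r))" by (simp add: Q_def)
      moreover have "25 / 6 * P = 2.5 * 5 * (1 + 2 * d) * (x + y)" by (simp add: P_def u_def)
      moreover have "2.5 * (sqrt 2 * (1 + sqrt d) * sqrt (d * u)) + 2.5 * 5 * (1 + 2 * d) * (x + y) \<le> l"
        using l by (simp only: u_def mult.assoc)
      ultimately show ?thesis
        using \<open>1.4 * (g * r) \<le> sqrt 2 * (1 + sqrt d) * sqrt (d * u)\<close> by linarith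
    qed
    then have "(5 * Q + 25 / 6 * P) * w \<le> l * w" using w0 by (intro mult_right_mono) auto
    moreover have "(5 * Q + 25 / 6 * P) * w = u * (5 * \<theta> + 25 / 6 * p)"
      by (simp add: w_def \<theta>_def p_def add_divide_distrib algebra_simps)
    ultimately show ?thesis by simp
  qed
  have poly: "(2 + (1.63 * \<theta> + 0.85 * p)\<^sup>2 / (1 - s)) * (1 + p / 3) \<le> 5 * \<theta> + 25 / 6 * p"
  proof -
    have "p * p \<le> p" "0 \<le> p * p * p" using p01 by (simp_all add: mult_left_le)
    \<comment> \<open>With \<theta> = 1 - p everything depends on p alone. This cubic is 100000
      times the difference of the two sides after multiplication by 1 - s; bounding p^2 by p leaves
      34310 - 33864 p > 0.\<close>
    then have "0 \<le> 34310 + 15716 * p - 49580 * (p * p) + 16470 * (p * p * p)"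
      using p01 by linarith
    then have "(2 * (1 - s) + (1.63 * \<theta> + 0.85 * p)\<^sup>2) * (1 + p / 3)
        \<le> (5 * \<theta> + 25 / 6 * p) * (1 - s)"
      unfolding s_def \<theta>(1) using p01 by (simp add: power2_eq_square power3_eq_cube field_simps)
    moreover have "2 + (1.63 * \<theta> + 0.85 * p)\<^sup>2 / (1 - s)
        = (2 * (1 - s) + (1.63 * \<theta> + 0.85 * p)\<^sup>2) / (1 - s)"
      using s by (simp add: field_simps)
    ultimately show ?thesis using s by (simp add: pos_divide_le_eq)
  qed
  have main: "2 * u + (b\<^sup>2 + d * w\<^sup>2) / (1 - s) \<le> l * w / (1 + w)"
  proof -
    have "(2 * u + (b\<^sup>2 + d * w\<^sup>2) / (1 - s)) * (1 + w)
        \<le> (2 * u + (1.63 * \<theta> + 0.85 * p)\<^sup>2 * u / (1 - s)) * (1 + p / 3)"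
      using bw s u w0 wp d by (intro mult_mono add_mono divide_right_mono) auto
    also have "\<dots> = u * ((2 + (1.63 * \<theta> + 0.85 * p)\<^sup>2 / (1 - s)) * (1 + p / 3))"
      by (simp add: algebra_simps)
    also have "\<dots> \<le> u * (5 * \<theta> + 25 / 6 * p)"
      using poly u by (intro mult_left_mono) auto
    also note lw
    finally show ?thesis using w0 by (simp add: pos_le_divide_eq)
  qed
  have ln_sq: "ln (1 - z\<^sup>2) = ln (1 + z) + ln (1 - z)" if "0 \<le> z" "z < 1" for z :: real
  proof -
    have "1 - z\<^sup>2 = (1 + z) * (1 - z)" by (simp add: power2_eq_square algebra_simps)
    then show ?thesis using that by (simp add: ln_mult)
  qed
  note log_b = ln_sq[OF b0 b_lt] and log_w = ln_sq[OF less_imp_le[OF w0] w1]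
  have "ln (1 + b) + d * ln (1 - w) \<le> 2 * x"
    using critical[OF w0 w1] by (simp add: b_def)
  moreover have "- ln (1 - b\<^sup>2) \<le> b\<^sup>2 / (1 - s)" using ln_s bs by simp
  moreover have "d * - ln (1 - w\<^sup>2) \<le> d * (w\<^sup>2 / (1 - s))"
    using ln_s[OF ws] d by (intro mult_left_mono) auto
  then have "- d * ln (1 + w) - d * ln (1 - w) \<le> d * w\<^sup>2 / (1 - s)"
    unfolding log_w by (simp add: algebra_simps)
  ultimately have "2 * y \<le> d * ln (1 + w) + l * w / (1 + w) + ln (1 - b)"
    using main log_b by (simp add: u_def add_divide_distrib)

  moreover have "(1 + w) * q \<le> 2.5 * (1 + 2 * v\<^sup>2) * (d + x) * (1 - b)"
  proof -
    \<comment> \<open>The variable h ranges over ]0,1[ and d h = (1 - h) / 2, so the estimates for w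
      and b become linear in h for all d at once.\<close>
    define h where "h = 1 / (1 + 2 * d)"
    have h: "0 < h" "h < 1" "d * h = (1 - h) / 2" using d by (auto simp: h_def field_simps)
    have wh: "w \<le> h / 3" using wd p01 d by (simp add: h_def field_simps)
    have "b \<le> h / 3 * (d * (4 * v - 2) + 2 * (v - 1))"
      unfolding b_def using wh q_le q h by (intro mult_mono) auto
    also have "\<dots> = (d * h * (4 * v - 2) + 2 * (v - 1) * h) / 3" by (simp add: algebra_simps)
    also have "\<dots> = (2 * v - 1 - h) / 3" unfolding h(3) by (simp add: field_simps)
    finally have b: "(4 - 2 * v + h) / 3 \<le> 1 - b" by simp
    have "d * (4 * v - 2) \<le> d * (2 * (v + 1))" using v d by (intro mult_left_mono) auto
    then have "q \<le> 2 * (v + 1) * (d + x)"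
      using q_le_x by (simp add: algebra_simps)
    then have "(1 + w) * q \<le> (1 + h / 3) * (2 * (v + 1) * (d + x))"
      using wh w0 q h by (intro mult_mono) auto
    also have "\<dots> = (d + x) * ((1 + h / 3) * (2 * (v + 1)))" by (simp only: mult_ac)
    also have "\<dots> \<le> (d + x) * (2.5 * (1 + 2 * v\<^sup>2) * ((4 - 2 * v + h) / 3))"
    \<comment> \<open>After multiplication by 3, the terms free of h and those linear in h are
      compared separately; the former is a polynomial inequality in z = v - 1 < 0.3.\<close>
    proof (rule mult_left_mono)
      define z where "z = v - 1"
      have z: "0 < z" "z < 0.3" using v v_gt_1 by (auto simp: z_def)
      have "z * z \<le> 0.3 * z" using z by (intro mult_right_mono) auto
      moreover have "z * z * z \<le> 0.3 * 0.3 * z" using z by (intro mult_right_mono mult_mono) auto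
      ultimately have "6 * (v + 1) \<le> 2.5 * (1 + 2 * v\<^sup>2) * (4 - 2 * v)"
        using z by (simp add: z_def power2_eq_square algebra_simps)
      moreover have "v \<le> v\<^sup>2" using v_gt_1 by (simp add: power2_eq_square)
      then have "h * (2 * (v + 1)) \<le> h * (2.5 * (1 + 2 * v\<^sup>2))"
        using h v_gt_1 by (intro mult_left_mono) auto
      ultimately show "(1 + h / 3) * (2 * (v + 1)) \<le> 2.5 * (1 + 2 * v\<^sup>2) * ((4 - 2 * v + h) / 3)"
        by (simp add: field_simps)
    qed (use d x in auto)
    also have "\<dots> = 2.5 * (1 + 2 * v\<^sup>2) * (d + x) * ((4 - 2 * v + h) / 3)" by simp
    also have "\<dots> \<le> 2.5 * (1 + 2 * v\<^sup>2) * (d + x) * (1 - b)"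
      using b d x by (intro mult_left_mono) auto
    finally show ?thesis .
  qed
  ultimately have "power_bound l y w"
    using w0 w1 b_lt by (simp add: power_bound_def b_def)
  then show ?thesis ..
qed

text \<open>Each regime of v uses only the part of the signal that it needs: for v \<ge> 1.3 the
  linear part suffices, and for v < 1.3 the maximum may be lowered to 5 while the square root part
  is kept.\<close>

lemma power_bound_exists:
  assumes y: "0 \<le> y"
    and l: "2.5 * sqrt 2 * (1 + sqrt d) * sqrt (d * (x + y))
      + 2.5 * max (exp (4 * x)) 5 * (1 + 2 * d) * (x + y) \<le> l"
  shows "\<exists>w. power_bound l y w"
proof (cases "1.3 \<le> v")
  case True
  have "0 \<le> 2.5 * sqrt 2 * (1 + sqrt d) * sqrt (d * (x + y))" using d x y by simp
  with l have "2.5 * max (v\<^sup>2) 5 * (1 + 2 * d) * (x + y) \<le> l" unfolding exp_4x by linarith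
  then show ?thesis by (rule large_x_bound[OF True y])
next
  case False
  have "2.5 * 5 * (1 + 2 * d) * (x + y) \<le> 2.5 * max (exp (4 * x)) 5 * (1 + 2 * d) * (x + y)"
    using d x y by (intro mult_right_mono mult_left_mono) auto
  then show ?thesis using small_x_bound[of y l] False y l by simp
qed

end

section \<open>Chi-square and Fisher distributions\<close>

definition std_gauss :: "real measure" where
  "std_gauss = density lborel (\<lambda>x. ennreal (std_normal_density x))"

lemma sets_std_gauss [simp, measurable_cong]: "sets std_gauss = sets borel"
  by (simp add: std_gauss_def)

lemma space_std_gauss [simp]: "space std_gauss = UNIV"
  by (simp add: std_gauss_def)

lemma prob_space_std_gauss: "prob_space std_gauss"
  unfolding std_gauss_def by (rule prob_space_normal_density) simp

lemma product_prob_space_std_gauss: "product_prob_space (\<lambda>_. std_gauss)"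
  by (simp add: product_prob_space_def product_prob_space_axioms_def product_sigma_finite_def
      prob_space_std_gauss prob_space_imp_sigma_finite)

lemma prob_space_PiM_std_gauss: "prob_space (PiM K (\<lambda>_. std_gauss))"
  by (intro prob_space_PiM prob_space_std_gauss)

lemma std_gauss_finite:
  assumes "finite A" shows "emeasure std_gauss A = 0"
proof -
  have "A \<in> null_sets lborel" using assms by (rule finite_imp_null_set_lborel)
  then have "A \<in> null_sets std_gauss"
    using absolutely_continuousI_density[of "\<lambda>x. ennreal (std_normal_density x)" lborel]
    by (auto simp: absolutely_continuous_def std_gauss_def)
  then show ?thesis by auto
qed

lemma std_gauss_interval_pos:
  assumes "l < u" shows "0 < emeasure std_gauss {l<..<u}"
proof (rule ccontr)
  assume "\<not> 0 < emeasure std_gauss {l<..<u}"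
  then have "{l<..<u} \<in> null_sets std_gauss" by (auto simp: null_sets_def)
  then have "AE x in lborel. x \<in> {l<..<u} \<longrightarrow> ennreal (std_normal_density x) = 0"
    unfolding std_gauss_def by (subst (asm) null_sets_density_iff) auto
  then have "AE x in lborel. x \<notin> {l<..<u}"
    by eventually_elim (use normal_density_pos[of 1 0] in \<open>simp add: ennreal_eq_0_iff not_le[symmetric]\<close>)
  then have "emeasure lborel {l<..<u} = 0"
    by (subst (asm) AE_iff_measurable[of "{l<..<u}"]) auto
  then show False using assms by simp
qed

section \<open>Chi-square laws: relabelling, absence of atoms, positive mass of intervals\<close>

lemma measurable_sum_squares [measurable]:
  assumes "I \<subseteq> K"
  shows "(\<lambda>z. \<Sum>i\<in>I. (z i)\<^sup>2 :: real) \<in> borel_measurable (PiM K (\<lambda>_. std_gauss))"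
proof (rule borel_measurable_sum)
  fix i assume "i \<in> I"
  then have "(\<lambda>z. z i) \<in> measurable (PiM K (\<lambda>_. std_gauss)) std_gauss"
    using assms by (intro measurable_component_singleton) auto
  then show "(\<lambda>z. (z i)\<^sup>2) \<in> borel_measurable (PiM K (\<lambda>_. std_gauss))"
    by (simp cong: measurable_cong_sets)
qed

lemma chi_square_eq: "chi_square d = distr (PiM {..<d} (\<lambda>_. std_gauss)) borel (\<lambda>z. \<Sum>i<d. (z i)\<^sup>2)"
  by (simp add: chi_square_def std_gauss_def)

text \<open>A bijection of index sets transports the definition from {..<d} to an arbitrary finite
  family, so that chi-square laws can be read off from any group of coordinates.\<close>

lemma distr_sum_squares:
  assumes "finite I"
  shows "distr (PiM I (\<lambda>_. std_gauss)) borel (\<lambda>z. \<Sum>i\<in>I. (z i)\<^sup>2) = chi_square (card I)"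
proof -
  let ?n = "{..<card I}" and ?G = "\<lambda>_. std_gauss"
  obtain f where f: "bij_betw f ?n I"
    using ex_bij_betw_nat_finite[OF assms] by (auto simp: atLeast0LessThan)
  have "PiM ?n ?G = distr (PiM I ?G) (PiM ?n ?G) (\<lambda>\<omega>. \<lambda>n\<in>?n. \<omega> (f n))"
    using f prob_space_std_gauss
    by (intro distr_PiM_reindex[symmetric]) (auto simp: bij_betw_def)
  moreover have "(\<lambda>\<omega>. \<lambda>n\<in>?n. \<omega> (f n)) \<in> measurable (PiM I ?G) (PiM ?n ?G)"
    using f by (intro measurable_restrict measurable_component_singleton) (auto simp: bij_betw_def)
  ultimately have "chi_square (card I)
      = distr (PiM I ?G) borel ((\<lambda>z. \<Sum>i\<in>?n. (z i)\<^sup>2) \<circ> (\<lambda>\<omega>. \<lambda>n\<in>?n. \<omega> (f n)))"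
    unfolding chi_square_eq by (subst distr_distr[symmetric]) (auto intro: measurable_sum_squares)
  also have "(\<lambda>z. \<Sum>i\<in>?n. (z i)\<^sup>2) \<circ> (\<lambda>\<omega>. \<lambda>n\<in>?n. \<omega> (f n)) = (\<lambda>z. \<Sum>i\<in>I. (z i :: real)\<^sup>2)"
    by (auto simp: fun_eq_iff simp flip: sum.reindex_bij_betw[OF f] intro!: sum.cong)
  finally show ?thesis by simp
qed

lemma sets_chi_square [simp, measurable_cong]: "sets (chi_square d) = sets borel"
  by (simp add: chi_square_def)

lemma space_chi_square [simp]: "space (chi_square d) = UNIV"
  by (simp add: chi_square_def)

lemma prob_space_chi_square: "prob_space (chi_square d)"
  unfolding chi_square_eq
  by (intro prob_space.prob_space_distr prob_space_PiM_std_gauss measurable_sum_squares order_refl)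

text \<open>Given all other coordinates, the last one is confined to the at most two roots of y^2 =
  c - s, a null set; Fubini concludes.\<close>

lemma chi_square_singleton:
  assumes "0 < d" shows "emeasure (chi_square d) {c} = 0"
proof -
  interpret product_prob_space "\<lambda>_::nat. std_gauss" UNIV by (rule product_prob_space_std_gauss)
  obtain d' where d': "d = Suc d'" using assms by (cases d) auto
  let ?P = "PiM (insert d' {..<d'}) (\<lambda>_. std_gauss)"
  let ?f = "\<lambda>z. indicator {c} (\<Sum>i\<in>insert d' {..<d'}. (z i)\<^sup>2 :: real) :: ennreal"
  have [measurable]: "(\<lambda>z. \<Sum>i\<in>insert d' {..<d'}. (z i)\<^sup>2 :: real) \<in> borel_measurable ?P"
    by (rule measurable_sum_squares) simp
  have "emeasure (chi_square d) {c} = (\<integral>\<^sup>+ x. indicator {c} x \<partial>chi_square d)" by simp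
  also have "\<dots> = integral\<^sup>N ?P ?f"
    unfolding chi_square_eq d' lessThan_Suc by (subst nn_integral_distr) auto
  also have "\<dots> = (\<integral>\<^sup>+ x. (\<integral>\<^sup>+ y. ?f (x(d' := y)) \<partial>std_gauss) \<partial>PiM {..<d'} (\<lambda>_. std_gauss))"
    by (rule product_nn_integral_insert) auto
  also have "\<dots> = 0"
  proof (rule nn_integral_zero')
    have "(\<integral>\<^sup>+ y. ?f (x(d' := y)) \<partial>std_gauss) = 0" for x
    proof -
      define s where "s = (\<Sum>i<d'. (x i)\<^sup>2)"
      have "?f (x(d' := y)) = indicator {y. y\<^sup>2 = c - s} y" for y
        by (auto simp: s_def indicator_def)
      then have "(\<integral>\<^sup>+ y. ?f (x(d' := y)) \<partial>std_gauss) = (\<integral>\<^sup>+ y. indicator {y. y\<^sup>2 = c - s} y \<partial>std_gauss)"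
        by simp
      also have "\<dots> = emeasure std_gauss {y. y\<^sup>2 = c - s}" by (subst nn_integral_indicator) auto
      also have "\<dots> = 0"
      proof (rule std_gauss_finite)
        have "{y. y\<^sup>2 = c - s} \<subseteq> {sqrt (c - s), - sqrt (c - s)}"
          by (auto simp: real_sqrt_unique) (metis abs_if minus_minus real_sqrt_abs)
        then show "finite {y. y\<^sup>2 = c - s}" by (rule finite_subset) simp
      qed
      finally show ?thesis .
    qed
    then show "AE x in PiM {..<d'} (\<lambda>_. std_gauss). (\<integral>\<^sup>+ y. ?f (x(d' := y)) \<partial>std_gauss) = 0"
      by simp
  qed
  finally show ?thesis .
qed

text \<open>If every coordinate lies between sqrt (a / d) and sqrt (b / d), the sum of squares lies
  in ]a,b[, and that box has positive Gaussian measure.\<close>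

lemma chi_square_interval_pos:
  assumes d: "0 < d" and ab: "0 \<le> a" "a < b"
  shows "0 < emeasure (chi_square d) {a<..<b}"
proof -
  interpret product_prob_space "\<lambda>_::nat. std_gauss" UNIV by (rule product_prob_space_std_gauss)
  interpret finite_product_sigma_finite "\<lambda>_::nat. std_gauss" "{..<d}" by standard simp
  let ?P = "PiM {..<d} (\<lambda>_. std_gauss)"
  let ?l = "sqrt (a / d)" and ?u = "sqrt (b / d)"
  have [measurable]: "(\<lambda>z. \<Sum>i<d. (z i)\<^sup>2 :: real) \<in> borel_measurable ?P"
    by (rule measurable_sum_squares) simp
  have lu: "?l < ?u" using d ab by (simp add: divide_strict_right_mono)
  have "(0::ennreal) < (\<Prod>i<d. emeasure std_gauss {?l<..<?u})"
    using std_gauss_interval_pos[OF lu] unfolding zero_less_iff_neq_zero by simp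
  also have "\<dots> = emeasure ?P (\<Pi>\<^sub>E i\<in>{..<d}. {?l<..<?u})" by (subst measure_times) auto
  also have "\<dots> \<le> emeasure ?P ((\<lambda>z. \<Sum>i<d. (z i)\<^sup>2) -` {a<..<b} \<inter> space ?P)"
  proof (rule emeasure_mono)
    show "(\<Pi>\<^sub>E i\<in>{..<d}. {?l<..<?u}) \<subseteq> (\<lambda>z. \<Sum>i<d. (z i)\<^sup>2) -` {a<..<b} \<inter> space ?P"
    proof
      fix z assume z: "z \<in> (\<Pi>\<^sub>E i\<in>{..<d}. {?l<..<?u})"
      have zi: "a / d < (z i)\<^sup>2" "(z i)\<^sup>2 < b / d" if "i < d" for i
      proof -
        have *: "?l < z i" "z i < ?u" using z that by (auto simp: PiE_iff)
        have "0 \<le> ?l" using ab by simp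
        with *(1) have "0 \<le> z i" by linarith
        have "?l\<^sup>2 < (z i)\<^sup>2" using * \<open>0 \<le> ?l\<close> by (intro power_strict_mono) auto
        moreover have "(z i)\<^sup>2 < ?u\<^sup>2" using * \<open>0 \<le> z i\<close> by (intro power_strict_mono) auto
        ultimately show "a / d < (z i)\<^sup>2" "(z i)\<^sup>2 < b / d" using ab by auto
      qed
      have "(\<Sum>i<d. a / d) < (\<Sum>i<d. (z i)\<^sup>2)" "(\<Sum>i<d. (z i)\<^sup>2) < (\<Sum>i<d. b / d)"
        by (rule sum_strict_mono; use zi d in force)+
      then show "z \<in> (\<lambda>z. \<Sum>i<d. (z i)\<^sup>2) -` {a<..<b} \<inter> space ?P"
        using z d by (auto simp: space_PiM PiE_iff)
    qed
  qed measurable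
  also have "\<dots> = emeasure (chi_square d) {a<..<b}"
    unfolding chi_square_eq by (subst emeasure_distr) auto
  finally show ?thesis .
qed

lemma chi_square_AE_pos:
  assumes "0 < d" shows "AE x in chi_square d. 0 < x"
proof -
  have "AE x in chi_square d. 0 \<le> x"
    unfolding chi_square_eq
    by (subst AE_distr_iff) (auto intro!: measurable_sum_squares sum_nonneg)
  moreover have "AE x in chi_square d. x \<noteq> 0"
    using chi_square_singleton[OF assms, of 0]
    by (intro AE_I[of _ _ "{0}"]) auto
  ultimately show ?thesis by eventually_elim auto
qed

section \<open>The Fisher law and its tail function\<close>

lemma measurable_ratio:
  "(\<lambda>(x, y). (x / real D) / (y / real N)) \<in> borel_measurable (chi_square D \<Otimes>\<^sub>M chi_square N)"
  by measurable

lemma real_distribution_fisher: "real_distribution (fisher D N)"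
proof -
  interpret D: prob_space "chi_square D" by (rule prob_space_chi_square)
  interpret N: prob_space "chi_square N" by (rule prob_space_chi_square)
  interpret pair_prob_space "chi_square D" "chi_square N" ..
  show ?thesis unfolding fisher_def real_distribution_def real_distribution_axioms_def
    using prob_space_distr[OF measurable_ratio] by simp
qed

text \<open>For a fixed numerator x > 0 the ratio equals u for at most one y. Positivity will give
  \<open>Fbar D N 0 = 1\<close>, and the absence of atoms the continuity of
  \<open>Fbar\<close>.\<close>

lemma fisher_AE:
  assumes "0 < D" "0 < N"
  shows "AE x in fisher D N. 0 < x \<and> x \<noteq> u"
proof -
  interpret D: prob_space "chi_square D" by (rule prob_space_chi_square)
  interpret N: prob_space "chi_square N" by (rule prob_space_chi_square)
  interpret pair_prob_space "chi_square D" "chi_square N" ..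
  have "AE x in chi_square D. AE y in chi_square N.
      0 < (x / real D) / (y / real N) \<and> (x / real D) / (y / real N) \<noteq> u"
    using chi_square_AE_pos[OF assms(1)]
  proof eventually_elim
    case (elim x)
    \<comment> \<open>For u = 0 the excluded point is 0 by the convention on division; the
      positivity of the ratio covers that case.\<close>
    have "AE y in chi_square N. y \<noteq> x / real D * real N / u"
      using chi_square_singleton[OF assms(2), of "x / real D * real N / u"]
      by (intro AE_I[of _ _ "{x / real D * real N / u}"]) auto
    with chi_square_AE_pos[OF assms(2)] show ?case
    proof eventually_elim
      case (elim y)
      have "0 < (x / real D) / (y / real N)" using elim \<open>0 < x\<close> assms by simp
      moreover have "y = x / real D * real N / u" if "(x / real D) / (y / real N) = u" "u \<noteq> 0"
        unfolding that(1)[symmetric] using elim \<open>0 < x\<close> assms by simp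
      ultimately show ?case using elim(2) by (metis less_irrefl)
    qed
  qed
  then have "AE p in chi_square D \<Otimes>\<^sub>M chi_square N.
      0 < (case p of (x, y) \<Rightarrow> (x / real D) / (y / real N)) \<and>
      (case p of (x, y) \<Rightarrow> (x / real D) / (y / real N)) \<noteq> u"
  proof (intro AE_pair_measure)
    note measurable_ratio[of D N, measurable]
    show "{p \<in> space (chi_square D \<Otimes>\<^sub>M chi_square N).
      0 < (case p of (x, y) \<Rightarrow> (x / real D) / (y / real N)) \<and>
      (case p of (x, y) \<Rightarrow> (x / real D) / (y / real N)) \<noteq> u} \<in> sets (chi_square D \<Otimes>\<^sub>M chi_square N)"
      by measurable
  qed simp
  then show ?thesis
    unfolding fisher_def by (subst AE_distr_iff[OF measurable_ratio]) auto
qed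

lemma Fbar_eq: "Fbar D N u = 1 - cdf (fisher D N) u"
proof -
  interpret real_distribution "fisher D N" by (rule real_distribution_fisher)
  have "{u<..} = space (fisher D N) - {..u}" by auto
  then show ?thesis unfolding Fbar_def cdf_def by (simp only: prob_compl sets.top) (simp add: prob_compl[of "{..u}", simplified])
qed

lemma Fbar_antimono: "u \<le> v \<Longrightarrow> Fbar D N v \<le> Fbar D N u"
proof -
  interpret real_distribution "fisher D N" by (rule real_distribution_fisher)
  show "u \<le> v \<Longrightarrow> Fbar D N v \<le> Fbar D N u"
    unfolding Fbar_def by (intro finite_measure_mono) auto
qed

lemma Fbar_nonneg: "0 \<le> Fbar D N u"
  by (simp add: Fbar_def)

lemma measurable_Fbar [measurable]: "Fbar D N \<in> borel_measurable borel"
proof -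
  have "mono (\<lambda>u. - Fbar D N u)" by (auto intro!: monoI Fbar_antimono)
  then have "(\<lambda>u. - Fbar D N u) \<in> borel_measurable borel" by (rule borel_measurable_mono)
  then have "(\<lambda>u. - (- Fbar D N u)) \<in> borel_measurable borel" by measurable
  then show ?thesis by simp
qed

text \<open>The mass of ]u,v] is positive because it contains the image of a rectangle: x / D in
  ]r,v[ and y / N in ]1,s[, with s so close to 1 that u s < r.\<close>

lemma Fbar_strict_antimono:
  assumes DN: "0 < D" "0 < N" and uv: "0 \<le> u" "u < v"
  shows "Fbar D N v < Fbar D N u"
proof -
  interpret real_distribution "fisher D N" by (rule real_distribution_fisher)
  interpret D: prob_space "chi_square D" by (rule prob_space_chi_square)
  interpret N: prob_space "chi_square N" by (rule prob_space_chi_square)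
  interpret P: pair_prob_space "chi_square D" "chi_square N" ..
  define r where "r = (u + v) / 2"
  have r: "u < r" "r < v" "0 < r" using uv by (auto simp: r_def)
  obtain s where s: "1 < s" "u * s < r"
  proof (cases "u = 0")
    case True then show ?thesis using that[of 2] r by simp
  next
    case False
    then have "1 < r / u" using r uv by simp
    then obtain s where "1 < s" "s < r / u" using dense by blast
    then show ?thesis using that[of s] False uv by (simp add: field_simps)
  qed
  let ?A = "{r * D<..<v * D}" and ?B = "{real N<..<s * N}"
  have "0 < emeasure (chi_square D) ?A * emeasure (chi_square N) ?B"
    using DN r s uv
    by (intro ennreal_zero_less_mult_iff[THEN iffD2] conjI chi_square_interval_pos) auto
  also have "\<dots> = emeasure (chi_square D \<Otimes>\<^sub>M chi_square N) (?A \<times> ?B)"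
    by (subst N.emeasure_pair_measure_Times) auto
  also have "\<dots> \<le> emeasure (chi_square D \<Otimes>\<^sub>M chi_square N)
      ((\<lambda>(x, y). (x / real D) / (y / real N)) -` {u<..v} \<inter> space (chi_square D \<Otimes>\<^sub>M chi_square N))"
  proof (rule emeasure_mono)
    show "?A \<times> ?B \<subseteq> (\<lambda>(x, y). (x / real D) / (y / real N)) -` {u<..v} \<inter> space (chi_square D \<Otimes>\<^sub>M chi_square N)"
    proof clarify
      fix x y assume xy: "x \<in> ?A" "y \<in> ?B"
      then have x: "r < x / D" "x / D < v" and y: "1 < y / N" "y / N < s"
        using DN by (auto simp: field_simps)
      have "u * (y / N) \<le> u * s" using uv y by (intro mult_left_mono) auto
      then have "u * (y / N) < x / D" using x s by linarith
      moreover have "v * 1 \<le> v * (y / N)" using uv y by (intro mult_left_mono) auto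
      then have "x / D \<le> v * (y / N)" using x by linarith
      ultimately have "u < (x / real D) / (y / real N)" "(x / real D) / (y / real N) \<le> v"
        using y by (simp_all only: pos_less_divide_eq pos_divide_le_eq less_trans[OF zero_less_one])
      then show "(x, y) \<in> (\<lambda>(x, y). (x / real D) / (y / real N)) -` {u<..v} \<inter> space (chi_square D \<Otimes>\<^sub>M chi_square N)"
        by (simp add: space_pair_measure)
    qed
  qed (intro measurable_sets[OF measurable_ratio], simp)
  also have "\<dots> = emeasure (fisher D N) {u<..v}"
    unfolding fisher_def by (subst emeasure_distr[OF measurable_ratio]) auto
  finally have "0 < prob {u<..v}" by (simp add: emeasure_eq_measure)
  moreover have "prob {u<..} = prob {u<..v} + prob {v<..}"
    using uv by (subst finite_measure_Union[symmetric]) (auto intro: arg_cong[where f = prob])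
  ultimately show ?thesis by (simp add: Fbar_def)
qed

lemma Fbar_zero:
  assumes "0 < D" "0 < N" shows "Fbar D N 0 = 1"
proof -
  interpret real_distribution "fisher D N" by (rule real_distribution_fisher)
  show ?thesis unfolding Fbar_def
    using fisher_AE[OF assms] by (subst prob_eq_1) auto
qed

text \<open>\<open>the_inv_into\<close> is meaningful only for values that are attained exactly
  once. Uniqueness is strict monotonicity; existence is the intermediate value theorem, from the
  value 1 at 0 down to a point where the tail is below a.\<close>

lemma Fbar_inv:
  assumes DN: "0 < D" "0 < N" and a: "0 < a" "a < 1"
  shows Fbar_inv_nonneg: "0 \<le> Fbar_inv D N a" and Fbar_Fbar_inv: "Fbar D N (Fbar_inv D N a) = a"
proof -
  interpret real_distribution "fisher D N" by (rule real_distribution_fisher)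
  have "inj_on (Fbar D N) {0..}"
    by (rule inj_onI) (metis Fbar_strict_antimono[OF DN] atLeast_iff less_irrefl linorder_neqE)
  moreover have "a \<in> Fbar D N ` {0..}"
  proof -
    have "\<forall>\<^sub>F i in sequentially. 1 - a < cdf (fisher D N) (real i)"
      using cdf_lim_infty_prob a by (intro order_tendstoD(1)) auto
    then obtain i :: nat where "1 - a < cdf (fisher D N) (real i)"
      by (auto simp: eventually_sequentially)
    then have "Fbar D N (real i) < a" by (simp add: Fbar_eq)
    moreover have "isCont (cdf (fisher D N)) u" for u
    proof -
      have "prob {u} = 0"
        using fisher_AE[OF DN, of u] by (subst prob_eq_0) auto
      then show ?thesis by (simp add: isCont_cdf)
    qed
    then have "isCont (Fbar D N) u" for u
      unfolding Fbar_eq[abs_def] by (intro continuous_intros)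
    ultimately have "\<exists>u\<ge>0. u \<le> real i \<and> Fbar D N u = a"
      using Fbar_zero[OF DN] a by (intro IVT2) auto
    then show ?thesis by auto
  qed
  ultimately show "0 \<le> Fbar_inv D N a" "Fbar D N (Fbar_inv D N a) = a"
    using the_inv_into_into[of "Fbar D N" "{0..}" a "{0..}"]
    unfolding Fbar_inv_def by (auto simp: f_the_inv_into_f)
qed

text \<open>The definition places numerator and denominator on separate spaces. Here both live on a
  single Gaussian family, and disjointness of the two groups of coordinates supplies the
  independence.\<close>

lemma fisher_eq_distr:
  assumes K: "finite K" and IJ: "I \<subseteq> K" "J \<subseteq> K" "I \<inter> J = {}"
  shows "fisher (card I) (card J) = distr (PiM K (\<lambda>_. std_gauss)) borel
    (\<lambda>z. ((\<Sum>i\<in>I. (z i)\<^sup>2) / card I) / ((\<Sum>i\<in>J. (z i)\<^sup>2) / card J))"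
proof -
  let ?G = "\<lambda>_. std_gauss"
  interpret product_prob_space ?G K by (rule product_prob_space_std_gauss)
  have fin: "finite I" "finite J" using K IJ by (auto intro: finite_subset)
  let ?s = "\<lambda>I z. \<Sum>i\<in>I. (z i)\<^sup>2 :: real"
  let ?r = "\<lambda>(x :: real, y :: real). (x / card I) / (y / card J)"
  let ?f = "\<lambda>z. ?r (?s I z, ?s J z)"
  have [measurable]: "?r \<in> borel_measurable (borel \<Otimes>\<^sub>M borel)" by measurable
  have [measurable]: "?s I \<in> borel_measurable (PiM I ?G)" "?s J \<in> borel_measurable (PiM J ?G)"
    by (auto intro: measurable_sum_squares)
  have f [measurable]: "?f \<in> borel_measurable (PiM (I \<union> J) ?G)"
  proof -
    have [measurable]: "?s I \<in> borel_measurable (PiM (I \<union> J) ?G)" "?s J \<in> borel_measurable (PiM (I \<union> J) ?G)"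
      by (auto intro: measurable_sum_squares)
    show ?thesis by measurable
  qed
  have "fisher (card I) (card J)
      = distr (distr (PiM I ?G) borel (?s I) \<Otimes>\<^sub>M distr (PiM J ?G) borel (?s J)) borel ?r"
    unfolding fisher_def distr_sum_squares[OF fin(1)] distr_sum_squares[OF fin(2)] ..
  also have "distr (PiM I ?G) borel (?s I) \<Otimes>\<^sub>M distr (PiM J ?G) borel (?s J)
      = distr (PiM I ?G \<Otimes>\<^sub>M PiM J ?G) (borel \<Otimes>\<^sub>M borel) (\<lambda>(x, y). (?s I x, ?s J y))"
    by (intro pair_measure_distr)
       (auto simp: distr_sum_squares fin prob_space_chi_square intro!: prob_space_imp_sigma_finite)
  also have "distr \<dots> borel ?r = distr (PiM I ?G \<Otimes>\<^sub>M PiM J ?G) borel (?r \<circ> (\<lambda>(x, y). (?s I x, ?s J y)))"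
    by (intro distr_distr) measurable
  also have "\<dots> = distr (PiM I ?G \<Otimes>\<^sub>M PiM J ?G) borel (?f \<circ> merge I J)"
  proof (intro distr_cong refl)
    fix p
    have "?s I (merge I J p) = ?s I (fst p)" "?s J (merge I J p) = ?s J (snd p)"
      using IJ(3) by (cases p; auto simp: merge_def intro!: sum.cong)+
    then show "(?r \<circ> (\<lambda>(x, y). (?s I x, ?s J y))) p = (?f \<circ> merge I J) p"
      by (cases p) simp
  qed
  also have "\<dots> = distr (distr (PiM I ?G \<Otimes>\<^sub>M PiM J ?G) (PiM (I \<union> J) ?G) (merge I J)) borel ?f"
    by (intro distr_distr[symmetric]) auto
  also have "distr (PiM I ?G \<Otimes>\<^sub>M PiM J ?G) (PiM (I \<union> J) ?G) (merge I J) = PiM (I \<union> J) ?G"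
    using IJ fin by (intro distr_merge) auto
  also have "\<dots> = distr (PiM K ?G) (PiM (I \<union> J) ?G) (\<lambda>f. restrict f (I \<union> J))"
    using IJ K by (intro distr_restrict) auto
  also have "distr \<dots> borel ?f = distr (PiM K ?G) borel (?f \<circ> (\<lambda>f. restrict f (I \<union> J)))"
    using IJ by (intro distr_distr) (auto intro!: measurable_restrict_subset)
  also have "\<dots> = distr (PiM K ?G) borel ?f"
    by (intro distr_cong refl) (simp cong: sum.cong)
  finally show ?thesis by simp
qed

section \<open>Exponential moments of Gaussian quadratic forms\<close>

text \<open>Completing the square makes the integrand a multiple of the normal density with mean 2 c
  m / (1 - 2 c) and variance 1 / (1 - 2 c). The normalising factor is kept as a logarithm in the
  exponent, so that products over coordinates become sums.\<close>

lemma std_gauss_mgf: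
  assumes c: "c < 1 / 2"
  shows "(\<integral>\<^sup>+ z. ennreal (exp (c * (m + z)\<^sup>2)) \<partial>std_gauss)
    = ennreal (exp (- (ln (1 - 2 * c) - 2 * c * m\<^sup>2 / (1 - 2 * c)) / 2))" (is "_ = ennreal ?R")
proof -
  define b where "b = 1 - 2 * c"
  have b: "0 < b" "c = (1 - b) / 2" using c by (auto simp: b_def)
  let ?\<tau> = "1 / sqrt b" and ?\<nu> = "2 * c * m / b"
  have eq: "std_normal_density z * exp (c * (m + z)\<^sup>2) = ?R * normal_density ?\<nu> ?\<tau> z" for z
  proof -
    have "?R = exp (c * m\<^sup>2 / b) / sqrt b"
    proof -
      have "- (ln b - 2 * c * m\<^sup>2 / b) / 2 = c * m\<^sup>2 / b - ln (sqrt b)"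
        using b by (simp add: ln_sqrt field_simps)
      then have "?R = exp (c * m\<^sup>2 / b - ln (sqrt b))" by (simp only: b_def)
      also have "\<dots> = exp (c * m\<^sup>2 / b) / sqrt b"
        using b(1) by (simp only: exp_diff exp_ln real_sqrt_gt_0_iff)
      finally show ?thesis .
    qed
    moreover have "c * (m + z)\<^sup>2 - z\<^sup>2 / 2 = c * m\<^sup>2 / b - (z - ?\<nu>)\<^sup>2 * b / 2"
    proof -
      have "(z - k / b)\<^sup>2 * b = b * z\<^sup>2 - 2 * k * z + k\<^sup>2 / b" for k
        using b(1) by (simp add: power2_eq_square field_simps)
      from this[of "(1 - b) * m"] have sq: "(z - ?\<nu>)\<^sup>2 * b = b * z\<^sup>2 - 2 * ((1 - b) * m) * z + ((1 - b) * m)\<^sup>2 / b"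
        by (simp add: b_def)
      define A where "A = (1 - b) * m\<^sup>2 / b"
      have A1: "((1 - b) * m)\<^sup>2 / b = A - (1 - b) * m\<^sup>2"
        using b(1) by (simp add: A_def power2_eq_square field_simps)
      have A2: "(1 - b) / 2 * m\<^sup>2 / b = A / 2" by (simp add: A_def)
      show ?thesis unfolding sq A1 unfolding b(2) A2 by (simp add: power2_eq_square field_simps)
    qed
    then have "exp (c * (m + z)\<^sup>2) * exp (- z\<^sup>2 / 2) = exp (c * m\<^sup>2 / b) * exp (- ((z - ?\<nu>)\<^sup>2 * b) / 2)"
      by (simp flip: exp_add)
    moreover have "normal_density ?\<nu> ?\<tau> z = sqrt b / sqrt (2 * pi) * exp (- ((z - ?\<nu>)\<^sup>2 * b) / 2)"
      using b(1) by (simp add: normal_density_def real_sqrt_mult real_sqrt_divide power_divide)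
    moreover have "std_normal_density z = 1 / sqrt (2 * pi) * exp (- z\<^sup>2 / 2)"
      by (simp add: std_normal_density_def)
    ultimately show ?thesis using b(1) by (simp add: mult_ac)
  qed
  have R: "0 \<le> ?R" by simp
  have "(\<integral>\<^sup>+ z. ennreal (exp (c * (m + z)\<^sup>2)) \<partial>std_gauss)
      = (\<integral>\<^sup>+ z. ennreal (std_normal_density z) * ennreal (exp (c * (m + z)\<^sup>2)) \<partial>lborel)"
    unfolding std_gauss_def by (subst nn_integral_density) auto
  also have "\<dots> = (\<integral>\<^sup>+ z. ennreal (?R * normal_density ?\<nu> ?\<tau> z) \<partial>lborel)"
    by (simp only: ennreal_mult'[symmetric] normal_density_nonneg eq)
  also have "\<dots> = ennreal ?R * (\<integral>\<^sup>+ z. ennreal (normal_density ?\<nu> ?\<tau> z) \<partial>lborel)"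
    using R by (simp add: ennreal_mult' nn_integral_cmult)
  also have "(\<integral>\<^sup>+ z. ennreal (normal_density ?\<nu> ?\<tau> z) \<partial>lborel) = 1"
    using b(1) by (subst nn_integral_eq_integral) auto
  finally show ?thesis by simp
qed

text \<open>Markov's inequality for the exponential of the form, whose mean factorises over the
  coordinates. The Chernoff parameter is absorbed into \<open>c\<close>, and the \<open>c i\<close>
  may have either sign, which is what allows differences of sums of squares.\<close>

lemma chernoff_quadratic:
  fixes c m :: "'i \<Rightarrow> real"
  assumes K: "finite K" and c: "\<And>i. i \<in> K \<Longrightarrow> c i < 1 / 2"
  shows "measure (PiM K (\<lambda>_. std_gauss))
      {z \<in> space (PiM K (\<lambda>_. std_gauss)). 0 \<le> (\<Sum>i\<in>K. c i * (m i + z i)\<^sup>2)}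
    \<le> exp (- (\<Sum>i\<in>K. ln (1 - 2 * c i) - 2 * c i * (m i)\<^sup>2 / (1 - 2 * c i)) / 2)"
proof -
  interpret product_prob_space "\<lambda>_. std_gauss" K by (rule product_prob_space_std_gauss)
  let ?P = "PiM K (\<lambda>_. std_gauss)"
  let ?S = "\<lambda>z. \<Sum>i\<in>K. c i * (m i + z i)\<^sup>2"
  let ?h = "\<lambda>i. ln (1 - 2 * c i) - 2 * c i * (m i)\<^sup>2 / (1 - 2 * c i)"
  have [measurable]: "?S \<in> borel_measurable ?P"
  proof (rule borel_measurable_sum)
    fix i assume "i \<in> K"
    then have "(\<lambda>z. z i) \<in> measurable ?P std_gauss" by (rule measurable_component_singleton)
    then have [measurable]: "(\<lambda>z. z i) \<in> borel_measurable ?P" by (simp cong: measurable_cong_sets)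
    show "(\<lambda>z. c i * (m i + z i)\<^sup>2) \<in> borel_measurable ?P" by measurable
  qed
  have "emeasure ?P {z \<in> space ?P. 0 \<le> ?S z} = (\<integral>\<^sup>+ z. indicator {z \<in> space ?P. 0 \<le> ?S z} z \<partial>?P)"
    by (subst nn_integral_indicator) auto
  also have "\<dots> \<le> (\<integral>\<^sup>+ z. (\<Prod>i\<in>K. ennreal (exp (c i * (m i + z i)\<^sup>2))) \<partial>?P)"
  proof (intro nn_integral_mono)
    fix z
    have "(\<Prod>i\<in>K. ennreal (exp (c i * (m i + z i)\<^sup>2))) = ennreal (exp (?S z))"
      using K by (simp add: exp_sum prod_ennreal)
    then show "indicator {z \<in> space ?P. 0 \<le> ?S z} z \<le> (\<Prod>i\<in>K. ennreal (exp (c i * (m i + z i)\<^sup>2)))"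
      by (auto simp: indicator_def)
  qed
  also have "\<dots> = (\<Prod>i\<in>K. \<integral>\<^sup>+ z. ennreal (exp (c i * (m i + z)\<^sup>2)) \<partial>std_gauss)"
    by (rule product_nn_integral_prod[OF K]) measurable
  also have "\<dots> = (\<Prod>i\<in>K. ennreal (exp (- ?h i / 2)))"
    using c by (intro prod.cong std_gauss_mgf) auto
  also have "\<dots> = ennreal (exp (- (\<Sum>i\<in>K. ?h i) / 2))"
  proof -
    have "(\<Sum>i\<in>K. - ?h i / 2) = - (\<Sum>i\<in>K. ?h i) / 2"
      by (simp only: sum_negf flip: sum_divide_distrib)
    then show ?thesis using exp_sum[OF K, of "\<lambda>i. - ?h i / 2"] by (simp add: prod_ennreal)
  qed
  finally show ?thesis by (simp add: emeasure_eq_measure)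
qed

lemma measurable_sum_quadratic:
  assumes "I \<subseteq> K"
  shows "(\<lambda>z. \<Sum>i\<in>I. c i * (m i + z i)\<^sup>2 :: real) \<in> borel_measurable (PiM K (\<lambda>_. std_gauss))"
proof (rule borel_measurable_sum)
  fix i assume "i \<in> I"
  then have "(\<lambda>z. z i) \<in> measurable (PiM K (\<lambda>_. std_gauss)) std_gauss"
    using assms by (intro measurable_component_singleton) auto
  then have [measurable]: "(\<lambda>z. z i) \<in> borel_measurable (PiM K (\<lambda>_. std_gauss))"
    by (simp cong: measurable_cong_sets)
  show "(\<lambda>z. c i * (m i + z i)\<^sup>2) \<in> borel_measurable (PiM K (\<lambda>_. std_gauss))" by measurable
qed

lemma fisher_tail:
  assumes K: "finite K" and IJ: "I \<subseteq> K" "J \<subseteq> K" "I \<inter> J = {}"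
  shows "measure (PiM K (\<lambda>_. std_gauss)) {z \<in> space (PiM K (\<lambda>_. std_gauss)).
      u < ((\<Sum>i\<in>I. (z i)\<^sup>2) / card I) / ((\<Sum>i\<in>J. (z i)\<^sup>2) / card J)} = Fbar (card I) (card J) u"
proof -
  have [measurable]: "(\<lambda>z. \<Sum>i\<in>I. (z i)\<^sup>2 :: real) \<in> borel_measurable (PiM K (\<lambda>_. std_gauss))"
    "(\<lambda>z. \<Sum>i\<in>J. (z i)\<^sup>2 :: real) \<in> borel_measurable (PiM K (\<lambda>_. std_gauss))"
    using IJ by (auto intro: measurable_sum_squares)
  show ?thesis
    unfolding Fbar_def fisher_eq_distr[OF assms]
    by (subst measure_distr) (auto intro!: arg_cong2[where f = measure])
qed

lemma AE_component_neq:
  assumes "j \<in> K" shows "AE z in PiM K (\<lambda>_. std_gauss). z j \<noteq> c"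
proof -
  have "AE x in std_gauss. x \<noteq> c"
    by (rule AE_I[of _ _ "{c}"]) (auto simp: std_gauss_finite)
  then have "AE x in distr (PiM K (\<lambda>_. std_gauss)) std_gauss (\<lambda>z. z j). x \<noteq> c"
    using assms by (subst distr_PiM_component) (auto simp: prob_space_std_gauss)
  then show ?thesis
    using assms by (subst (asm) AE_distr_iff) (auto intro: measurable_component_singleton)
qed

text \<open>The weights are r / 2 on I, s / 2 on J and 0 on the remaining coordinates, which will be
  the directions of the smaller model.\<close>

lemma chernoff_difference:
  fixes I J :: "'i set" and m :: "'i \<Rightarrow> real"
  assumes K: "finite K" and IJ: "I \<subseteq> K" "J \<subseteq> K" "I \<inter> J = {}"
    and r: "r < 1" "s < 1"
  shows "measure (PiM K (\<lambda>_. std_gauss)) {z \<in> space (PiM K (\<lambda>_. std_gauss)).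
      0 \<le> r * (\<Sum>i\<in>I. (m i + z i)\<^sup>2) + s * (\<Sum>i\<in>J. (m i + z i)\<^sup>2)}
    \<le> exp (- (card I * ln (1 - r) - r * (\<Sum>i\<in>I. (m i)\<^sup>2) / (1 - r)
             + card J * ln (1 - s) - s * (\<Sum>i\<in>J. (m i)\<^sup>2) / (1 - s)) / 2)"
proof -
  define c where "c i = (if i \<in> I then r / 2 else if i \<in> J then s / 2 else 0)" for i
  have fin: "finite I" "finite J" using K IJ by (auto intro: finite_subset)
  have split: "(\<Sum>i\<in>K. if i \<in> I then f i else if i \<in> J then g i else 0) = sum f I + sum g J"
    for f g :: "'i \<Rightarrow> real"
  proof -
    have "(\<Sum>i\<in>K. if i \<in> I then f i else if i \<in> J then g i else 0)
        = (\<Sum>i\<in>I \<union> J. if i \<in> I then f i else if i \<in> J then g i else 0)"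
      using K IJ by (intro sum.mono_neutral_right) auto
    also have "\<dots> = (\<Sum>i\<in>I. if i \<in> I then f i else if i \<in> J then g i else 0)
        + (\<Sum>i\<in>J. if i \<in> I then f i else if i \<in> J then g i else 0)"
      using fin IJ by (intro sum.union_disjoint) auto
    also have "\<dots> = sum f I + sum g J"
      using IJ by (intro arg_cong2[where f = "(+)"] sum.cong) auto
    finally show ?thesis .
  qed
  have e1: "(\<Sum>i\<in>K. c i * (m i + z i)\<^sup>2)
      = (r * (\<Sum>i\<in>I. (m i + z i)\<^sup>2) + s * (\<Sum>i\<in>J. (m i + z i)\<^sup>2)) / 2" for z
  proof -
    have "(\<Sum>i\<in>K. c i * (m i + z i)\<^sup>2)
        = (\<Sum>i\<in>K. if i \<in> I then r / 2 * (m i + z i)\<^sup>2 else if i \<in> J then s / 2 * (m i + z i)\<^sup>2 else 0)"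
      by (intro sum.cong) (auto simp: c_def)
    then show ?thesis by (simp add: split sum_distrib_left sum_divide_distrib add_divide_distrib)
  qed
  have e2: "(\<Sum>i\<in>K. ln (1 - 2 * c i) - 2 * c i * (m i)\<^sup>2 / (1 - 2 * c i))
      = card I * ln (1 - r) - r * (\<Sum>i\<in>I. (m i)\<^sup>2) / (1 - r)
        + card J * ln (1 - s) - s * (\<Sum>i\<in>J. (m i)\<^sup>2) / (1 - s)"
  proof -
    have "(\<Sum>i\<in>K. ln (1 - 2 * c i) - 2 * c i * (m i)\<^sup>2 / (1 - 2 * c i))
        = (\<Sum>i\<in>K. if i \<in> I then ln (1 - r) - r / (1 - r) * (m i)\<^sup>2
            else if i \<in> J then ln (1 - s) - s / (1 - s) * (m i)\<^sup>2 else 0)"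
      by (intro sum.cong) (auto simp: c_def)
    also have "\<dots> = (\<Sum>i\<in>I. ln (1 - r) - r / (1 - r) * (m i)\<^sup>2)
        + (\<Sum>i\<in>J. ln (1 - s) - s / (1 - s) * (m i)\<^sup>2)" by (rule split)
    finally have eq: "(\<Sum>i\<in>K. ln (1 - 2 * c i) - 2 * c i * (m i)\<^sup>2 / (1 - 2 * c i)) = \<dots>" .
    show ?thesis unfolding eq by (simp add: sum_subtractf sum_distrib_left sum_divide_distrib)
  qed
  have "c i < 1 / 2" for i using r by (simp add: c_def)
  from chernoff_quadratic[where c = c and m = m, OF K this] show ?thesis unfolding e1 e2 by simp
qed

text \<open>Rejection has probability exactly a and implies w A - w q B \<ge> 0, so the central
  Chernoff bound with r = w and s = - w q is an upper bound for a. Its logarithm, divided by N, is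
  the required inequality.\<close>

lemma critical_value_Fbar_inv:
  assumes DN: "0 < D" "0 < N" and a: "0 < a" "a < 1"
  shows "critical_value (real D / real N) (ln (1 / a) / real N) (Fbar_inv D N a * (real D / real N))"
proof
  let ?Q = "Fbar_inv D N a"
  let ?q = "?Q * (real D / real N)"
  have Q: "0 \<le> ?Q" "Fbar D N ?Q = a"
    using Fbar_inv_nonneg[OF assms] Fbar_Fbar_inv[OF assms] .
  show "0 < real D / real N" "0 < ln (1 / a) / real N" "0 \<le> ?q" using assms Q by simp_all
  fix w :: real assume w: "0 < w" "w < 1"
  define I where "I = {..<D}"
  define J where "J = {D..<D + N}"
  define K where "K = {..<D + N}"
  have IJ: "finite K" "I \<subseteq> K" "J \<subseteq> K" "I \<inter> J = {}" "card I = D" "card J = N"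
    by (auto simp: I_def J_def K_def)
  let ?P = "PiM K (\<lambda>_. std_gauss)"
  interpret P: prob_space ?P by (rule prob_space_PiM_std_gauss)
  define A where "A = (\<lambda>z :: nat \<Rightarrow> real. \<Sum>i\<in>I. (z i)\<^sup>2)"
  define B where "B = (\<lambda>z :: nat \<Rightarrow> real. \<Sum>i\<in>J. (z i)\<^sup>2)"
  have [measurable]: "A \<in> borel_measurable ?P" "B \<in> borel_measurable ?P"
    unfolding A_def B_def using IJ by (auto intro: measurable_sum_squares)
  have "a = P.prob {z \<in> space ?P. ?Q < (A z / D) / (B z / N)}"
    using fisher_tail[OF IJ(1-4), of ?Q] Q IJ by (simp add: A_def B_def)
  also have "\<dots> \<le> P.prob {z \<in> space ?P. 0 \<le> w * A z + (- (w * ?q)) * B z}"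
  proof (rule P.finite_measure_mono)
    have "0 \<le> w * A z + (- (w * ?q)) * B z" if *: "?Q < (A z / D) / (B z / N)" for z
    proof -
      \<comment> \<open>A vanishing denominator would make the quotient 0, which does not exceed the
        nonnegative critical value.\<close>
      have "B z \<noteq> 0" using * Q(1) by auto
      then have B: "0 < B z" by (simp add: B_def sum_nonneg less_le)
      have "?q * B z \<le> A z" using * B DN by (simp add: field_simps)
      then have "w * (?q * B z) \<le> w * A z" using w by (intro mult_left_mono) auto
      then show ?thesis by simp
    qed
    then show "{z \<in> space ?P. ?Q < (A z / D) / (B z / N)}
      \<subseteq> {z \<in> space ?P. 0 \<le> w * A z + (- (w * ?q)) * B z}" by blast
  qed measurable
  also have "\<dots> \<le> exp (- (D * ln (1 - w) + N * ln (1 + w * ?q)) / 2)"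
  proof -
    have "0 \<le> w * ?q" using w Q by simp
    then have "- (w * ?q) < 1" by linarith
    from chernoff_difference[OF IJ(1-4) w(2) this, of "\<lambda>_. 0"] show ?thesis
      using IJ by (simp add: A_def B_def)
  qed
  finally have "a \<le> exp (- (D * ln (1 - w) + N * ln (1 + w * ?q)) / 2)" .
  then have "ln a \<le> - (D * ln (1 - w) + N * ln (1 + w * ?q)) / 2"
    using a by (metis exp_le_cancel_iff exp_ln)
  then have "N * ln (1 + w * ?q) + D * ln (1 - w) \<le> 2 * ln (1 / a)"
    using a by (simp add: ln_div)
  then have "(N * ln (1 + w * ?q) + D * ln (1 - w)) / N \<le> 2 * ln (1 / a) / N"
    by (intro divide_right_mono) auto
  then show "ln (1 + w * ?q) + real D / real N * ln (1 - w) \<le> 2 * (ln (1 / a) / real N)"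
    using DN by (simp add: add_divide_distrib)
qed

text \<open>Acceptance implies w q B - w A \<ge> 0, which is estimated with r = - w and s = w q; the
  exponential moment is finite because w q < 1. The first term of \<open>signal\<close> pays for the
  noncentrality of B, the rest is N l.\<close>

lemma noncentral_test_bound:
  fixes m :: "'i \<Rightarrow> real"
  assumes K: "finite K" and IJ: "I \<subseteq> K" "J \<subseteq> K" "I \<inter> J = {}"
    and D: "card I = D" "0 < D" and N: "card J = N" "0 < N"
    and a: "0 < a" "a < 1" and y: "0 \<le> y"
    and x_eq: "x = ln (1 / a) / N" and d_eq: "d = real D / real N"
    and signal: "2.5 * (1 + 2 * exp (4 * x)) * (d + x) * (\<Sum>i\<in>J. (m i)\<^sup>2)
        + N * (2.5 * sqrt 2 * (1 + sqrt d) * sqrt (d * (x + y))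
             + 2.5 * max (exp (4 * x)) 5 * (1 + 2 * d) * (x + y))
      \<le> (\<Sum>i\<in>I. (m i)\<^sup>2)"
  shows "measure (PiM K (\<lambda>_. std_gauss)) {z \<in> space (PiM K (\<lambda>_. std_gauss)).
      ((\<Sum>i\<in>I. (m i + z i)\<^sup>2) / D) / ((\<Sum>i\<in>J. (m i + z i)\<^sup>2) / N) \<le> Fbar_inv D N a} \<le> exp (- N * y)"
proof -
  define q where "q = Fbar_inv D N a * d"
  interpret critical_value d x q
    unfolding q_def x_eq d_eq by (rule critical_value_Fbar_inv[OF D(2) N(2) a])
  define l where "l = 2.5 * sqrt 2 * (1 + sqrt d) * sqrt (d * (x + y))
             + 2.5 * max (exp (4 * x)) 5 * (1 + 2 * d) * (x + y)"
  obtain w where "power_bound l y w"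
    using power_bound_exists[OF y, of l] by (auto simp: l_def)
  then have w: "0 < w" "w < 1" "w * q < 1"
    and rho: "(1 + w) * q \<le> 2.5 * (1 + 2 * v\<^sup>2) * (d + x) * (1 - w * q)"
    and main: "2 * y \<le> d * ln (1 + w) + l * w / (1 + w) + ln (1 - w * q)"
    by (auto simp: power_bound_def)
  let ?P = "PiM K (\<lambda>_. std_gauss)"
  interpret P: prob_space ?P by (rule prob_space_PiM_std_gauss)
  define A where "A = (\<lambda>z. \<Sum>i\<in>I. (m i + z i)\<^sup>2)"
  define B where "B = (\<lambda>z. \<Sum>i\<in>J. (m i + z i)\<^sup>2)"
  let ?lam = "\<Sum>i\<in>I. (m i)\<^sup>2" and ?rho = "\<Sum>i\<in>J. (m i)\<^sup>2"
  have [measurable]: "A \<in> borel_measurable ?P" "B \<in> borel_measurable ?P"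
    using measurable_sum_quadratic[OF IJ(1), of "\<lambda>_. 1" m] measurable_sum_quadratic[OF IJ(2), of "\<lambda>_. 1" m]
    by (simp_all add: A_def B_def)
  have fin: "finite J" using K IJ by (auto intro: finite_subset)
  obtain j where j: "j \<in> J" using N by (metis card_gt_0_iff ex_in_conv)
  \<comment> \<open>By the convention on division, B = 0 would count as acceptance. It forces z j =
    - m j for every j in J, a null event.\<close>
  have "AE z in ?P. z j \<noteq> - m j" using j IJ by (intro AE_component_neq) auto
  then have AE: "AE z in ?P. z \<in> {z \<in> space ?P. A z / D / (B z / N) \<le> Fbar_inv D N a}
      \<longrightarrow> z \<in> {z \<in> space ?P. 0 \<le> (- w) * A z + (w * q) * B z}"
  proof eventually_elim
    case (elim z)
    have "(0::real) < (m j + z j)\<^sup>2" using elim by (simp add: add_eq_0_iff)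
    also have "\<dots> \<le> B z" unfolding B_def using j fin by (intro member_le_sum) auto
    finally have B: "0 < B z" .
    have "0 \<le> (- w) * A z + (w * q) * B z" if "A z / D / (B z / N) \<le> Fbar_inv D N a"
    proof -
      have "A z \<le> q * B z" using that B D N by (simp add: q_def d_eq field_simps)
      then have "w * A z \<le> w * (q * B z)" using w by (intro mult_left_mono) auto
      then show ?thesis by simp
    qed
    then show ?case by blast
  qed
  have "P.prob {z \<in> space ?P. A z / D / (B z / N) \<le> Fbar_inv D N a}
      \<le> P.prob {z \<in> space ?P. 0 \<le> (- w) * A z + (w * q) * B z}"
    using AE by (rule P.finite_measure_mono_AE) measurable
  also have "\<dots> \<le> exp (- (D * ln (1 + w) + w * ?lam / (1 + w)
        + N * ln (1 - w * q) - w * q * ?rho / (1 - w * q)) / 2)"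
    using chernoff_difference[OF K IJ, of "- w" "w * q" m] w D N by (simp add: A_def B_def)
  also have "\<dots> \<le> exp (- N * y)"
  proof -
    have "w * q * ?rho / (1 - w * q) + N * (l * w / (1 + w)) \<le> w * ?lam / (1 + w)"
    proof -
      have "q / (1 - w * q) \<le> 2.5 * (1 + 2 * v\<^sup>2) * (d + x) / (1 + w)"
        using rho w by (simp add: frac_le_eq field_simps)
      then have "(w * ?rho) * (q / (1 - w * q)) \<le> (w * ?rho) * (2.5 * (1 + 2 * v\<^sup>2) * (d + x) / (1 + w))"
        using w by (intro mult_left_mono mult_nonneg_nonneg sum_nonneg) auto
      moreover have "w * (2.5 * (1 + 2 * v\<^sup>2) * (d + x) * ?rho + N * l) / (1 + w) \<le> w * ?lam / (1 + w)"
        using signal w by (intro divide_right_mono mult_left_mono) (auto simp: l_def exp_4x)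
      ultimately show ?thesis by (simp add: add_divide_distrib distrib_left mult_ac)
    qed
    moreover have "N * (2 * y) \<le> N * (d * ln (1 + w) + l * w / (1 + w) + ln (1 - w * q))"
      using main by (intro mult_left_mono) auto
    moreover have "N * (d * ln (1 + w)) = D * ln (1 + w)" using N by (simp add: d_eq)
    ultimately show ?thesis by (simp add: distrib_left)
  qed
  finally show ?thesis by (simp add: A_def B_def)
qed

section \<open>Rotation invariance of the Gaussian distribution\<close>

text \<open>
  The Lebesgue measure of linear images is only available for well-ordered index types, hence a
  well-ordered copy of an arbitrary finite type.
\<close>

typedef 'n idx = "{..<CARD('n::finite)}"
  by (rule exI[of _ 0]) simp

instantiation idx :: (finite) "{finite, wellorder}"
begin

definition less_eq_idx :: "'a idx \<Rightarrow> 'a idx \<Rightarrow> bool" where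
  "less_eq_idx i j \<longleftrightarrow> Rep_idx i \<le> Rep_idx j"

definition less_idx :: "'a idx \<Rightarrow> 'a idx \<Rightarrow> bool" where
  "less_idx i j \<longleftrightarrow> Rep_idx i < Rep_idx j"

instance
proof
  fix i j k :: "'a idx"
  show "i < j \<longleftrightarrow> i \<le> j \<and> \<not> j \<le> i" "i \<le> i" "i \<le> j \<or> j \<le> i"
    by (auto simp: less_eq_idx_def less_idx_def)
  show "i \<le> j \<Longrightarrow> j \<le> k \<Longrightarrow> i \<le> k" by (simp add: less_eq_idx_def)
  show "i \<le> j \<Longrightarrow> j \<le> i \<Longrightarrow> i = j" by (simp add: less_eq_idx_def Rep_idx_inject)
next
  fix P :: "'a idx \<Rightarrow> bool" and i
  assume *: "\<And>i. (\<And>j. j < i \<Longrightarrow> P j) \<Longrightarrow> P i"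
  show "P i"
    by (rule measure_induct_rule[of Rep_idx]) (rule *[unfolded less_idx_def], blast)
next
  have "(UNIV :: 'a idx set) = Abs_idx ` {..<CARD('a)}"
    by (rule type_definition.Abs_image[OF type_definition_idx, symmetric])
  then show "finite (UNIV :: 'a idx set)" by (metis finite_imageI finite_lessThan)
qed

end

lemma card_idx: "CARD('n idx) = CARD('n::finite)"
  by (simp add: type_definition.card[OF type_definition_idx])

section \<open>Invariance of Lebesgue measure under orthogonal maps\<close>

lemma lborel_vec_reindex:
  fixes r :: "'m::finite \<Rightarrow> 'n::finite"
  assumes r: "bij r"
  shows "distr lborel borel (\<lambda>x :: real ^ 'n. \<chi> j. x $ r j) = lborel"
proof (rule lborel_eqI[symmetric])
  let ?h = "\<lambda>x :: real ^ 'n. \<chi> j. x $ r j"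
  have [measurable]: "?h \<in> borel_measurable borel"
    by (intro borel_measurable_continuous_onI continuous_intros)
  show "sets (distr lborel borel ?h) = sets borel" by simp
  have Basis_prod: "(\<Prod>b\<in>Basis. f \<bullet> b) = (\<Prod>i\<in>UNIV. f $ i)" for f :: "real ^ 'k"
    by (simp add: Basis_vec_def UNION_singleton_eq_range prod.reindex inj_on_def axis_eq_axis inner_axis)
  fix l u :: "real ^ 'm" assume lu: "\<And>b. b \<in> Basis \<Longrightarrow> l \<bullet> b \<le> u \<bullet> b"
  let ?l = "\<chi> i. l $ inv r i" and ?u = "\<chi> i. u $ inv r i"
  have "?h -` box l u = box ?l ?u"
    using bij_inv_eq_iff[OF r] bij_is_surj[OF r] bij_is_inj[OF r]
    by (auto simp: mem_box_cart) (metis surj_f_inv_f inv_f_f)+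
  then have "emeasure (distr lborel borel ?h) (box l u) = emeasure lborel (box ?l ?u)"
    by (subst emeasure_distr) auto
  also have "\<dots> = (\<Prod>b\<in>Basis. (?u - ?l) \<bullet> b)"
  proof (rule emeasure_lborel_box)
    fix b :: "real ^ 'n" assume "b \<in> Basis"
    then obtain i where b: "b = axis i 1" by (auto simp: Basis_vec_def)
    have "l $ inv r i \<le> u $ inv r i"
      using lu[of "axis (inv r i) 1"] by (auto simp: inner_axis Basis_vec_def)
    then show "?l \<bullet> b \<le> ?u \<bullet> b" by (simp add: b inner_axis)
  qed
  also have "(\<Prod>b\<in>Basis. (?u - ?l) \<bullet> b) = (\<Prod>i\<in>UNIV. (u - l) $ inv r i)"
    unfolding Basis_prod by simp
  also have "\<dots> = (\<Prod>j\<in>UNIV. (u - l) $ j)"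
    using prod.reindex_bij_betw[OF bij_imp_bij_inv[OF r], of "\<lambda>j. (u - l) $ j"] by simp
  finally show "emeasure (distr lborel borel ?h) (box l u) = ennreal (\<Prod>b\<in>Basis. (u - l) \<bullet> b)"
    unfolding Basis_prod by simp
qed

lemma lborel_orthogonal_wellorder:
  fixes f :: "real ^ 'n::{finite, wellorder} \<Rightarrow> real ^ 'n::_"
  assumes f: "orthogonal_transformation f"
  shows "distr lborel borel f = lborel"
proof (rule lborel_eqI[symmetric])
  have [measurable]: "f \<in> borel_measurable borel"
    using f by (intro borel_measurable_continuous_onI linear_continuous_on)
      (simp add: orthogonal_transformation_linear linear_conv_bounded_linear[symmetric])
  show "sets (distr lborel borel f) = sets borel" by simp
  define g where "g = inv f"
  have g: "orthogonal_transformation g" unfolding g_def by (rule orthogonal_transformation_inv[OF f])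
  fix l u :: "real ^ 'n::_" assume lu: "\<And>b. b \<in> Basis \<Longrightarrow> l \<bullet> b \<le> u \<bullet> b"
  have vim: "f -` box l u = g ` box l u"
    unfolding g_def using orthogonal_transformation_bij[OF f] by (rule bij_vimage_eq_inv_image)
  have meas: "f -` box l u \<in> sets borel"
    using measurable_sets[of f borel borel "box l u"] by simp
  have gm: "g ` box l u \<in> lmeasurable" by (rule measurable_orthogonal_image[OF g]) simp
  have "emeasure (distr lborel borel f) (box l u) = emeasure lborel (f -` box l u)"
    by (subst emeasure_distr) auto
  also have "\<dots> = emeasure lebesgue (g ` box l u)"
    using meas unfolding vim by simp
  also have "\<dots> = ennreal (measure lebesgue (g ` box l u))"
    using gm by (simp add: emeasure_eq_measure2)
  also have "\<dots> = ennreal (measure lebesgue (box l u))"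
    by (simp add: measure_orthogonal_image[OF g])
  also have "\<dots> = ennreal (\<Prod>b\<in>Basis. (u - l) \<bullet> b)"
    using lu by (simp add: measure_lborel_box_eq)
  finally show "emeasure (distr lborel borel f) (box l u) = ennreal (\<Prod>b\<in>Basis. (u - l) \<bullet> b)" .
qed

text \<open>Conjugation with the relabelling \<open>h\<close> gives an orthogonal map over the
  well-ordered copy of the index type. Since \<open>h\<close> and its inverse preserve both inner
  products and Lebesgue measure, the invariance is transported back.\<close>

lemma lborel_orthogonal:
  fixes f :: "real ^ 'n \<Rightarrow> real ^ 'n"
  assumes f: "orthogonal_transformation f"
  shows "distr lborel borel f = lborel"
proof -
  obtain r :: "'n idx \<Rightarrow> 'n" where r: "bij r"
    using finite_same_card_bij[of "UNIV :: 'n idx set" "UNIV :: 'n set"] card_idx[where 'n = 'n]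
    by auto
  define h :: "real ^ 'n \<Rightarrow> real ^ 'n idx" where "h x = (\<chi> j. x $ r j)" for x
  define h' :: "real ^ 'n idx \<Rightarrow> real ^ 'n" where "h' x = (\<chi> i. x $ inv r i)" for x
  have hh: "h (h' x) = x" "h' (h y) = y" for x y
    using bij_is_surj[OF r] bij_is_inj[OF r]
    by (auto simp: h_def h'_def vec_eq_iff surj_f_inv_f inv_f_f)
  have d: "distr lborel borel h = lborel" "distr lborel borel h' = lborel"
    using lborel_vec_reindex[OF r] lborel_vec_reindex[OF bij_imp_bij_inv[OF r]]
    by (simp_all add: h_def[abs_def] h'_def[abs_def])
  have inner: "h x \<bullet> h y = x \<bullet> y" for x y
    using sum.reindex_bij_betw[of r UNIV UNIV "\<lambda>i. x $ i * y $ i"] r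
    by (simp add: h_def inner_vec_def)
  have inner': "h' x \<bullet> h' y = x \<bullet> y" for x y
    using inner[of "h' x" "h' y"] by (simp add: hh)
  have lin: "linear h" "linear h'"
    by (auto intro!: linearI simp: h_def h'_def vec_eq_iff)
  have F: "orthogonal_transformation (h \<circ> f \<circ> h')"
    using f lin by (auto simp: orthogonal_transformation_def inner inner' intro!: linear_compose)
  have [measurable]: "h \<in> borel_measurable borel" "h' \<in> borel_measurable borel" "f \<in> borel_measurable borel"
    using lin orthogonal_transformation_linear[OF f]
    by (auto intro!: borel_measurable_continuous_onI linear_continuous_on
        simp: linear_conv_bounded_linear[symmetric])
  have "distr lborel borel f = distr lborel borel (h' \<circ> ((h \<circ> f \<circ> h') \<circ> h))"
    by (simp add: comp_def hh)
  also have "\<dots> = distr (distr (distr lborel borel h) borel (h \<circ> f \<circ> h')) borel h'"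
    by (simp add: distr_distr comp_assoc)
  also have "\<dots> = lborel"
    unfolding d(1) lborel_orthogonal_wellorder[OF F] d(2) ..
  finally show ?thesis .
qed

section \<open>Isotropic Gaussian vectors in orthonormal coordinates\<close>

lemma iso_normal_density_eq:
  "iso_normal_density \<sigma> (x :: real ^ 'n) = (1 / sqrt (2 * pi * \<sigma>\<^sup>2)) ^ CARD('n) * exp (- (norm x)\<^sup>2 / (2 * \<sigma>\<^sup>2))"
proof -
  have "(norm x)\<^sup>2 = (\<Sum>i\<in>UNIV. (x $ i)\<^sup>2)"
    unfolding power2_norm_eq_inner inner_vec_def by (simp add: power2_eq_square)
  then show ?thesis
    by (simp add: iso_normal_density_def normal_density_def prod.distrib prod_dividef
        exp_sum[symmetric] sum_negf sum_divide_distrib power_divide)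
qed

text \<open>The synthesis map from coordinates to vectors is a linear isometry by a direct
  computation; taking coordinates is its inverse.\<close>

lemma orthonormal_coordinates:
  fixes e :: "'n::finite \<Rightarrow> real ^ 'n"
  assumes e: "\<And>i j. e i \<bullet> e j = (if i = j then 1 else 0)"
  shows "orthogonal_transformation (\<lambda>y. \<chi> i. e i \<bullet> y)"
proof -
  let ?T = "\<lambda>z :: real ^ 'n. \<Sum>i\<in>UNIV. z $ i *\<^sub>R e i"
  have "?T z \<bullet> ?T z = z \<bullet> z" for z
  proof -
    have "z \<bullet> z = (\<Sum>i\<in>UNIV. z $ i * z $ i)" by (simp add: inner_vec_def)
    then show ?thesis by (simp add: inner_sum_left inner_sum_right e if_distrib cong: if_cong)
  qed
  then have "norm (?T z) = norm z" for z by (simp add: norm_eq_sqrt_inner)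
  then have T: "orthogonal_transformation ?T"
    by (auto simp: orthogonal_transformation intro!: linearI
        simp: scaleR_add_left sum.distrib scaleR_sum_right)
  have "(\<lambda>y. \<chi> i. e i \<bullet> y) = inv ?T"
  proof
    fix y
    have h: "(\<chi> i. e i \<bullet> ?T z) = z" for z
      by (simp add: vec_eq_iff inner_sum_right e if_distrib cong: if_cong)
    have k: "?T (inv ?T y) = y"
      by (rule surj_f_inv_f[OF orthogonal_transformation_surj[OF T]])
    show "(\<chi> i. e i \<bullet> y) = inv ?T y"
      using h[of "inv ?T y"] unfolding k .
  qed
  then show ?thesis using orthogonal_transformation_inv[OF T] by simp
qed

lemma gauss_interval_scale:
  assumes \<sigma>: "0 < \<sigma>" and A: "A \<in> sets borel"
  shows "(\<integral>\<^sup>+ x. ennreal (normal_density 0 \<sigma> x) * indicator A (x / \<sigma>) \<partial>lborel) = emeasure std_gauss A"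
proof -
  have [measurable]: "A \<in> sets borel" by fact
  have eq: "ennreal \<sigma> * ennreal (normal_density 0 \<sigma> (\<sigma> * x)) = ennreal (std_normal_density x)" for x
  proof -
    have "\<sigma> * normal_density 0 \<sigma> (\<sigma> * x) = std_normal_density x"
      using \<sigma> by (simp add: normal_density_def real_sqrt_mult power_mult_distrib)
    then show ?thesis using \<sigma> by (metis ennreal_mult' less_imp_le)
  qed
  have "(\<integral>\<^sup>+ x. ennreal (normal_density 0 \<sigma> x) * indicator A (x / \<sigma>) \<partial>lborel)
      = ennreal \<sigma> * (\<integral>\<^sup>+ x. ennreal (normal_density 0 \<sigma> (\<sigma> * x)) * indicator A x \<partial>lborel)"
    using \<sigma> by (subst nn_integral_real_affine[of _ \<sigma> 0]) auto
  also have "\<dots> = (\<integral>\<^sup>+ x. ennreal \<sigma> * (ennreal (normal_density 0 \<sigma> (\<sigma> * x)) * indicator A x) \<partial>lborel)"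
    by (rule nn_integral_cmult[symmetric]) measurable
  also have "\<dots> = (\<integral>\<^sup>+ x. ennreal (std_normal_density x) * indicator A x \<partial>lborel)"
    by (simp only: mult.assoc[symmetric] eq)
  also have "\<dots> = emeasure std_gauss A"
    unfolding std_gauss_def by (subst emeasure_density) auto
  finally show ?thesis .
qed

text \<open>The density depends only on the norm and Lebesgue measure is rotation invariant, so the
  probability of a rectangle in the new coordinates is an integral that factorises. Rectangles
  determine the product measure.\<close>

lemma distr_orthonormal_coordinates:
  fixes e :: "'n::finite \<Rightarrow> real ^ 'n" and \<epsilon> :: "'a \<Rightarrow> real ^ 'n"
  assumes \<sigma>: "0 < \<sigma>"
    and \<epsilon>: "distributed M lborel \<epsilon> (\<lambda>x. ennreal (iso_normal_density \<sigma> x))"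
    and e: "\<And>i j. e i \<bullet> e j = (if i = j then 1 else 0)"
  shows "distr M (PiM UNIV (\<lambda>_. std_gauss)) (\<lambda>\<omega> i. (e i \<bullet> \<epsilon> \<omega>) / \<sigma>) = PiM UNIV (\<lambda>_. std_gauss)"
proof -
  interpret product_prob_space "\<lambda>_::'n. std_gauss" UNIV by (rule product_prob_space_std_gauss)
  let ?R = "\<lambda>y. \<chi> i. e i \<bullet> y"
  have R: "orthogonal_transformation ?R" by (rule orthonormal_coordinates[OF e])
  have [measurable]: "\<epsilon> \<in> borel_measurable M" using distributed_measurable[OF \<epsilon>] by simp
  have mR [measurable]: "?R \<in> borel_measurable borel"
    by (intro borel_measurable_continuous_onI continuous_intros)
  have meas: "(\<lambda>\<omega> i. (e i \<bullet> \<epsilon> \<omega>) / \<sigma>) \<in> measurable M (PiM UNIV (\<lambda>_. std_gauss))"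
    by (rule measurable_PiM_single') (auto simp: measurable_cong_sets[OF refl sets_std_gauss])
  show ?thesis
  proof (rule PiM_eqI)
    fix A :: "'n \<Rightarrow> real set" assume "\<And>i. i \<in> UNIV \<Longrightarrow> A i \<in> sets std_gauss"
    then have A [measurable]: "A i \<in> sets borel" for i by simp
    let ?E = "{y :: real ^ 'n. \<forall>i. (e i \<bullet> y) / \<sigma> \<in> A i}"
    let ?g = "\<lambda>x :: real ^ 'n. \<Prod>i\<in>UNIV. ennreal (normal_density 0 \<sigma> (x $ i)) * indicator (A i) (x $ i / \<sigma>)"
    have g [measurable]: "?g \<in> borel_measurable borel"
    proof -
      have [measurable]: "(\<lambda>x :: real ^ 'n. x $ i) \<in> borel_measurable borel" for i
        by (intro borel_measurable_continuous_onI continuous_intros)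
      show ?thesis by measurable
    qed
    have E [measurable]: "?E \<in> sets borel" by measurable
    have "emeasure (distr M (PiM UNIV (\<lambda>_. std_gauss)) (\<lambda>\<omega> i. (e i \<bullet> \<epsilon> \<omega>) / \<sigma>)) (PiE UNIV A)
        = emeasure M (\<epsilon> -` ?E \<inter> space M)"
      by (subst emeasure_distr[OF meas])
        (auto intro!: sets_PiM_I_finite arg_cong2[where f = emeasure])
    also have "\<dots> = (\<integral>\<^sup>+ y. ennreal (iso_normal_density \<sigma> y) * indicator ?E y \<partial>lborel)"
      by (rule distributed_emeasure[OF \<epsilon>]) simp
    also have "\<dots> = (\<integral>\<^sup>+ y. ?g (?R y) \<partial>lborel)"
    proof (rule nn_integral_cong)
      fix y
      have "norm (?R y) = norm y" using R by (simp add: orthogonal_transformation)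
      then have "iso_normal_density \<sigma> y = iso_normal_density \<sigma> (?R y)"
        by (simp only: iso_normal_density_eq)
      moreover have "indicator ?E y = (\<Prod>i\<in>UNIV. indicator (A i) (?R y $ i / \<sigma>) :: ennreal)"
        by (auto simp: indicator_def prod_zero_iff)
      ultimately show "ennreal (iso_normal_density \<sigma> y) * indicator ?E y = ?g (?R y)"
        by (simp only: prod.distrib iso_normal_density_def prod_ennreal normal_density_nonneg)
    qed
    also have "\<dots> = (\<integral>\<^sup>+ x. ?g x \<partial>distr lborel borel ?R)"
      by (subst nn_integral_distr) auto
    also have "\<dots> = (\<integral>\<^sup>+ x. ?g x \<partial>lborel)" by (simp only: lborel_orthogonal[OF R])
    also have "\<dots> = (\<Prod>i\<in>UNIV. emeasure std_gauss (A i))"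
    proof -
      \<comment> \<open>The product formula for \<open>lborel\<close> is indexed by basis vectors
        rather than by coordinates; the choice operator recovers the unique i with b = axis i
        1.\<close>
      define h where "h b x = ennreal (normal_density 0 \<sigma> x)
        * indicator (A (SOME i. b = axis i 1)) (x / \<sigma>)" for b :: "real ^ 'n" and x
      have Basis: "prod f Basis = (\<Prod>i\<in>UNIV. f (axis i 1))" for f :: "real ^ 'n \<Rightarrow> ennreal"
        by (simp add: Basis_vec_def UNION_singleton_eq_range prod.reindex inj_on_def axis_eq_axis)
      have h: "h (axis i 1) = (\<lambda>x. ennreal (normal_density 0 \<sigma> x) * indicator (A i) (x / \<sigma>))" for i
        by (simp add: h_def fun_eq_iff axis_eq_axis)
      have "?g x = (\<Prod>b\<in>Basis. h b (x \<bullet> b))" for x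
        unfolding Basis by (simp add: h inner_axis)
      then have "(\<integral>\<^sup>+ x. ?g x \<partial>lborel) = (\<Prod>b\<in>Basis. \<integral>\<^sup>+ x. h b x \<partial>lborel)"
        by (simp only:) (rule nn_integral_lborel_prod; simp add: h_def)
      also have "\<dots> = (\<Prod>i\<in>UNIV. emeasure std_gauss (A i))"
        unfolding Basis h by (simp add: gauss_interval_scale[OF \<sigma> A])
      finally show ?thesis .
    qed
    finally show "emeasure (distr M (PiM UNIV (\<lambda>_. std_gauss)) (\<lambda>\<omega> i. (e i \<bullet> \<epsilon> \<omega>) / \<sigma>)) (PiE UNIV A)
        = (\<Prod>i\<in>UNIV. emeasure std_gauss (A i))" .
  qed simp_all
qed

section \<open>Geometry of the nested models\<close>

lemma orth_proj:
  assumes "subspace V"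
  shows orth_proj_in: "orth_proj V y \<in> V"
    and diff_orth_proj: "y - orth_proj V y \<in> orthogonal_comp V"
  using theI'[OF orth_proj_unique[OF assms, of y]] by (simp_all add: orth_proj_def)

lemma orth_proj_eqI:
  assumes "subspace V" "v \<in> V" "y - v \<in> orthogonal_comp V"
  shows "orth_proj V y = v"
  unfolding orth_proj_def using orth_proj_unique[OF assms(1), of y] assms(2,3)
  by (intro the1_equality) auto

lemma orth_proj_orthogonal_comp:
  assumes "subspace V"
  shows "orth_proj (orthogonal_comp V) y = y - orth_proj V y"
  using orth_proj[OF assms, of y] orthogonal_comp_subset[of V]
  by (intro orth_proj_eqI subspace_orthogonal_comp) auto

lemma norm_n_sq: "(norm_n (s :: real ^ 'n))\<^sup>2 = (norm s)\<^sup>2 / real CARD('n)"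
proof -
  have "(norm s)\<^sup>2 = (\<Sum>i\<in>UNIV. (s $ i)\<^sup>2)"
    unfolding power2_norm_eq_inner inner_vec_def by (simp add: power2_eq_square)
  then show ?thesis by (simp add: norm_n_def sum_nonneg)
qed

lemma orth_proj_orthonormal:
  fixes e :: "'n::finite \<Rightarrow> real ^ 'n"
  assumes e: "\<And>i j. e i \<bullet> e j = (if i = j then 1 else 0)"
  shows "orth_proj (span (e ` I)) y = (\<Sum>i\<in>I. (e i \<bullet> y) *\<^sub>R e i)"
proof (rule orth_proj_eqI)
  let ?v = "\<Sum>i\<in>I. (e i \<bullet> y) *\<^sub>R e i"
  show "?v \<in> span (e ` I)" by (intro span_sum span_scale span_base) auto
  have *: "e j \<bullet> (y - ?v) = 0" if "j \<in> I" for j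
    using that by (simp add: inner_diff_right inner_sum_right e if_distrib cong: if_cong)
  have "orthogonal x (y - ?v)" if "x \<in> span (e ` I)" for x
  proof -
    have "orthogonal (y - ?v) x"
      using that by (rule orthogonal_to_span) (use * in \<open>auto simp: orthogonal_def inner_commute\<close>)
    then show ?thesis by (simp add: orthogonal_commute)
  qed
  then show "y - ?v \<in> orthogonal_comp (span (e ` I))" by (simp add: orthogonal_comp_def)
qed simp

lemma norm_orth_proj_orthonormal:
  fixes e :: "'n::finite \<Rightarrow> real ^ 'n"
  assumes e: "\<And>i j. e i \<bullet> e j = (if i = j then 1 else 0)"
  shows "(norm (orth_proj (span (e ` I)) y))\<^sup>2 = (\<Sum>i\<in>I. (e i \<bullet> y)\<^sup>2)"
  unfolding orth_proj_orthonormal[OF e] power2_norm_eq_inner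
  by (simp add: inner_sum_left inner_sum_right e if_distrib power2_eq_square cong: if_cong)

text \<open>Each generator of the second summand differs from X j by an element of the first, so
  projecting does not change the joint span. Dimension and nestedness of the models become visible
  in this form.\<close>

lemma VS_sp_eq:
  fixes X :: "nat \<Rightarrow> real ^ 'n"
  shows "VS_sp X k t = span (X ` {1..k + 2 ^ t})"
proof -
  define V where "V = V_sp X k"
  define A where "A = X ` {1..k}"
  define J where "J = {k + 1..k + 2 ^ t}"
  let ?P = "\<lambda>j. orth_proj (orthogonal_comp V) (X j)"
  have V: "V = span A" "subspace V" by (simp_all add: V_def V_sp_def A_def)
  have d: "X j - ?P j \<in> V" for j
    unfolding orth_proj_orthogonal_comp[OF V(2)] using orth_proj_in[OF V(2)] by simp
  have "VS_sp X k t = span (A \<union> ?P ` J)"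
    unfolding VS_sp_def S_sp_def V_def[symmetric] J_def[symmetric] V(1) span_Un
    by (auto simp: set_plus_def)
  also have "\<dots> = span (A \<union> X ` J)"
  proof (rule antisym; rule span_minimal; (rule subspace_span)?; rule Un_least)
    have V1: "v \<in> V \<Longrightarrow> v \<in> span (A \<union> X ` J)" and V2: "v \<in> V \<Longrightarrow> v \<in> span (A \<union> ?P ` J)" for v
      unfolding V(1) by (meson Un_upper1 span_mono subsetD)+
    show "A \<subseteq> span (A \<union> X ` J)" "A \<subseteq> span (A \<union> ?P ` J)" by (auto intro: span_base)
    show "?P ` J \<subseteq> span (A \<union> X ` J)"
    proof
      fix v assume "v \<in> ?P ` J"
      then obtain j where j: "j \<in> J" "v = ?P j" by auto
      have "X j - (X j - ?P j) \<in> span (A \<union> X ` J)"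
        by (rule span_diff[OF span_base V1[OF d]]) (use j in auto)
      then show "v \<in> span (A \<union> X ` J)" by (simp add: j)
    qed
    show "X ` J \<subseteq> span (A \<union> ?P ` J)"
    proof
      fix v assume "v \<in> X ` J"
      then obtain j where j: "j \<in> J" "v = X j" by auto
      have "?P j + (X j - ?P j) \<in> span (A \<union> ?P ` J)"
        by (rule span_add[OF span_base V2[OF d]]) (use j in auto)
      then show "v \<in> span (A \<union> ?P ` J)" by (simp add: j)
    qed
  qed
  also have "A \<union> X ` J = X ` {1..k + 2 ^ t}"
    unfolding A_def J_def image_Un[symmetric] by (rule arg_cong[of _ _ "image X"]) auto
  finally show ?thesis .
qed

lemma S_sp_orthogonal: "S_sp X k t \<subseteq> orthogonal_comp (V_sp X k)"
  unfolding S_sp_def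
  by (rule span_minimal) (auto simp: subspace_orthogonal_comp intro!: orth_proj_in)

text \<open>Orthonormal bases of the three mutually orthogonal spaces together form a basis of the
  whole space, hence can be indexed by \<open>'n\<close> itself. I and J are the indices of the last
  two.\<close>

lemma adapted_orthonormal_basis:
  fixes X :: "nat \<Rightarrow> real ^ 'n"
  assumes inj: "inj_on X {1..p}" and indep: "independent (X ` {1..p})"
    and kt: "k + 2 ^ t \<le> p"
  obtains e :: "'n \<Rightarrow> real ^ 'n" and I J where
    "\<And>i j. e i \<bullet> e j = (if i = j then 1 else 0)" "I \<inter> J = {}"
    "card I = 2 ^ t" "card J = CARD('n) - (k + 2 ^ t)"
    "S_sp X k t = span (e ` I)" "orthogonal_comp (VS_sp X k t) = span (e ` J)"
proof -
  let ?V = "V_sp X k" and ?S = "S_sp X k t" and ?U = "VS_sp X k t"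
  have sub: "subspace ?V" "subspace ?S" "subspace ?U" "subspace (orthogonal_comp ?U)"
    by (simp_all add: V_sp_def S_sp_def VS_sp_eq subspace_orthogonal_comp)
  have dimX: "dim (X ` {1..j}) = j" if "j \<le> p" for j
  proof -
    have sub: "{1..j} \<subseteq> {1..p}" using that by auto
    have "independent (X ` {1..j})" "inj_on X {1..j}"
      using independent_mono[OF indep image_mono[OF sub]] inj_on_subset[OF inj sub] .
    then show ?thesis by (simp add: dim_eq_card_independent card_image)
  qed
  have dimV: "dim ?V = k" using dimX[of k] kt by (simp add: V_sp_def)
  have dimU: "dim ?U = k + 2 ^ t" using dimX[OF kt] by (simp add: VS_sp_eq)
  obtain BV where BV: "BV \<subseteq> ?V" "pairwise orthogonal BV" "\<And>x. x \<in> BV \<Longrightarrow> norm x = 1"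
    "independent BV" "card BV = dim ?V" "span BV = ?V"
    using orthonormal_basis_subspace[OF sub(1)] by metis
  obtain BS where BS: "BS \<subseteq> ?S" "pairwise orthogonal BS" "\<And>x. x \<in> BS \<Longrightarrow> norm x = 1"
    "independent BS" "card BS = dim ?S" "span BS = ?S"
    using orthonormal_basis_subspace[OF sub(2)] by metis
  obtain BW where BW: "BW \<subseteq> orthogonal_comp ?U" "pairwise orthogonal BW" "\<And>x. x \<in> BW \<Longrightarrow> norm x = 1"
    "independent BW" "card BW = dim (orthogonal_comp ?U)" "span BW = orthogonal_comp ?U"
    using orthonormal_basis_subspace[OF sub(4)] by metis
  have U: "?U = {x + y | x y. x \<in> ?V \<and> y \<in> ?S}" by (auto simp: VS_sp_def set_plus_def)
  have VU: "?V \<subseteq> ?U"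
  proof
    fix x assume "x \<in> ?V"
    then have "x + 0 \<in> ?U" unfolding U using sub(2) subspace_0 by blast
    then show "x \<in> ?U" by simp
  qed
  have SU: "?S \<subseteq> ?U"
  proof
    fix x assume "x \<in> ?S"
    then have "0 + x \<in> ?U" unfolding U using sub(1) subspace_0 by blast
    then show "x \<in> ?U" by simp
  qed
  have orth: "orthogonal x y" if "x \<in> BV \<and> y \<in> BS \<or> x \<in> BV \<and> y \<in> BW \<or> x \<in> BS \<and> y \<in> BW" for x y
    using that BV(1) BS(1) BW(1) VU SU S_sp_orthogonal[of X k t] by (fastforce simp: orthogonal_comp_def)
  have norm1: "norm x = 1" if "x \<in> BV \<union> BS \<union> BW" for x
    using that BV(3) BS(3) BW(3) by auto
  have disj: "BV \<inter> BS = {}" "BV \<inter> BW = {}" "BS \<inter> BW = {}"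
    using orth norm1 by (force simp: orthogonal_self)+
  have pair: "pairwise orthogonal (BV \<union> BS \<union> BW)"
    using BV(2) BS(2) BW(2) orth unfolding pairwise_def by (metis Un_iff orthogonal_commute)
  have ind: "independent B" if "B \<subseteq> BV \<union> BS \<union> BW" for B
  proof (rule pairwise_orthogonal_independent)
    show "pairwise orthogonal B" using pair that by (rule pairwise_subset)
    show "0 \<notin> B" using norm1[of 0] that by auto
  qed
  have fin: "finite BV" "finite BS" "finite BW"
    using BV(4) BS(4) BW(4) by (auto intro: independent_imp_finite)
  have spanU: "span (BV \<union> BS) = ?U"
    unfolding span_Un BV(6) BS(6) U by auto
  have spanUNIV: "span (BV \<union> BS \<union> BW) = UNIV"
  proof -
    have "span (BV \<union> BS \<union> BW) = ?U + orthogonal_comp ?U"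
      unfolding span_Un[of "BV \<union> BS"] spanU BW(6) by (auto simp: set_plus_def)
    then show ?thesis using subspace_sum_orthogonal_comp[OF sub(3)] by simp
  qed
  \<comment> \<open>The dimension of \<open>S_sp X k t\<close> is obtained as the difference of
    those of the two models, which are k + 2^t and k by independence of the columns.\<close>
  have "card (BV \<union> BS) = dim ?U"
    using ind[of "BV \<union> BS"] dim_span_eq_card_independent[of "BV \<union> BS"] spanU by auto
  then have cS: "card BS = 2 ^ t"
    using card_Un_disjoint[OF fin(1,2) disj(1)] BV(5) dimU dimV by simp
  have cB: "card (BV \<union> BS \<union> BW) = CARD('n)"
    using ind[of "BV \<union> BS \<union> BW"] dim_span_eq_card_independent[of "BV \<union> BS \<union> BW"] spanUNIV
    by simp
  then have cW: "card BW = CARD('n) - (k + 2 ^ t)"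
    using card_Un_disjoint[of "BV \<union> BS" BW] Int_Un_distrib2[of BV BS BW] fin disj \<open>card (BV \<union> BS) = dim ?U\<close> dimU by auto
  obtain e :: "'n \<Rightarrow> real ^ 'n" where e: "bij_betw e UNIV (BV \<union> BS \<union> BW)"
    using finite_same_card_bij[of "UNIV :: 'n set" "BV \<union> BS \<union> BW"] fin cB by auto
  have img: "e ` (e -` C) = C" if "C \<subseteq> BV \<union> BS \<union> BW" for C
    using e that by (auto simp: bij_betw_def)
  have cimg: "card (e -` C) = card C" if "C \<subseteq> BV \<union> BS \<union> BW" for C
    using card_image[of e "e -` C"] e img[OF that] by (metis bij_betw_imp_inj_on inj_on_subset subset_UNIV)
  show thesis
  proof (rule that[of e "e -` BS" "e -` BW"])
    fix i j
    have B: "e i \<in> BV \<union> BS \<union> BW" for i using e by (auto simp: bij_betw_def)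
    have "e i \<noteq> e j" if "i \<noteq> j" using e that by (auto simp: bij_betw_def inj_on_def)
    then show "e i \<bullet> e j = (if i = j then 1 else 0)"
      using pair B[of i] B[of j] norm1[OF B[of i]]
      by (auto simp: pairwise_def orthogonal_def norm_eq_1)
  next
    have sub: "BS \<subseteq> BV \<union> BS \<union> BW" "BW \<subseteq> BV \<union> BS \<union> BW" by auto
    show "e -` BS \<inter> e -` BW = {}" using disj by auto
    show "card (e -` BS) = 2 ^ t" "card (e -` BW) = CARD('n) - (k + 2 ^ t)"
      using cimg[OF sub(1)] cimg[OF sub(2)] cS cW by auto
    show "S_sp X k t = span (e ` (e -` BS))" "orthogonal_comp (VS_sp X k t) = span (e ` (e -` BW))"
      unfolding img[OF sub(1)] img[OF sub(2)] BS(6) BW(6) by (rule refl)+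
  qed
qed

text \<open>As k < p, the logarithm is nonnegative, so \<open>nat\<close> does not truncate and
  membership means 2^t \<le> p - k.\<close>

lemma T_set_le:
  assumes "t \<in> T_set p k" "k < p"
  shows "k + 2 ^ t \<le> p"
proof -
  have "1 \<le> real p - real k" using assms(2) by linarith
  then have "0 \<le> log 2 (real p - real k)" by simp
  moreover have "t \<le> nat \<lfloor>log 2 (real p - real k)\<rfloor>" using assms(1) by (simp add: T_set_def)
  ultimately have "real t \<le> log 2 (real p - real k)" by linarith
  then have "2 powr real t \<le> real p - real k"
    using \<open>1 \<le> real p - real k\<close> by (simp add: le_log_iff)
  then have "real (k + 2 ^ t) \<le> real p" by (simp add: powr_realpow)
  then show ?thesis by (simp only: of_nat_le_iff)
qed

lemma T_set_finite: "finite (T_set p k)" "T_set p k \<noteq> {}"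
  by (auto simp: T_set_def)

section \<open>The tests of one Gaussian design\<close>

locale gaussian_design = prob_space M for M :: "'a measure" +
  fixes \<epsilon> :: "'a \<Rightarrow> real ^ 'n" and \<sigma> :: real and X :: "nat \<Rightarrow> real ^ 'n" and p :: nat
  assumes \<sigma>: "0 < \<sigma>"
    and noise: "distributed M lborel \<epsilon> (\<lambda>x. ennreal (iso_normal_density \<sigma> x))"
    and p: "p < CARD('n)"
    and inj: "inj_on X {1..p}" and indep: "independent (X ` {1..p})"
begin

lemma measurable_noise [measurable]: "\<epsilon> \<in> borel_measurable M"
  using distributed_measurable[OF noise] by simp

lemma N_df_pos: "k + 2 ^ t \<le> p \<Longrightarrow> 0 < N_df CARD('n) k t"
  using p by (simp add: N_df_def)

lemma D_df_pos: "0 < D_df t"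
  by (simp add: D_df_def)

text \<open>Coordinates in the adapted basis are divided by \<sigma>, which makes the noise
  standard; \<sigma> and the sample size in \<open>norm_n\<close> cancel in the statistic.
  Additivity of \<open>c\<close> lets the mean enter as a shift.\<close>

lemma test_coordinates:
  assumes kt: "k + 2 ^ t \<le> p"
  obtains c :: "real ^ 'n \<Rightarrow> 'n \<Rightarrow> real" and I J where
    "\<And>y z i. c (y + z) i = c y i + c z i"
    "I \<inter> J = {}" "card I = D_df t" "card J = N_df CARD('n) k t"
    "\<And>y. real CARD('n) * (norm_n (orth_proj (S_sp X k t) y))\<^sup>2 = \<sigma>\<^sup>2 * (\<Sum>i\<in>I. (c y i)\<^sup>2)"
    "\<And>y. real CARD('n) * (norm_n (orth_proj (orthogonal_comp (VS_sp X k t)) y))\<^sup>2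
      = \<sigma>\<^sup>2 * (\<Sum>i\<in>J. (c y i)\<^sup>2)"
    "\<And>y. F_stat X k t y
      = ((\<Sum>i\<in>I. (c y i)\<^sup>2) / D_df t) / ((\<Sum>i\<in>J. (c y i)\<^sup>2) / N_df CARD('n) k t)"
    "(\<lambda>\<omega>. c (\<epsilon> \<omega>)) \<in> measurable M (PiM UNIV (\<lambda>_. std_gauss))"
    "distr M (PiM UNIV (\<lambda>_. std_gauss)) (\<lambda>\<omega>. c (\<epsilon> \<omega>)) = PiM UNIV (\<lambda>_. std_gauss)"
    "\<And>i. (\<lambda>y. c y i) \<in> borel_measurable borel"
proof -
  obtain e :: "'n \<Rightarrow> real ^ 'n" and I J where e: "\<And>i j. e i \<bullet> e j = (if i = j then 1 else 0)"
    and IJ: "I \<inter> J = {}" "card I = 2 ^ t" "card J = CARD('n) - (k + 2 ^ t)"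
    and S: "S_sp X k t = span (e ` I)" and W: "orthogonal_comp (VS_sp X k t) = span (e ` J)"
    using adapted_orthonormal_basis[OF inj indep kt] by metis
  define c where "c y i = (e i \<bullet> y) / \<sigma>" for y i
  have sq: "(\<Sum>i\<in>K. (e i \<bullet> y)\<^sup>2) = \<sigma>\<^sup>2 * (\<Sum>i\<in>K. (c y i)\<^sup>2)" for K y
    using \<sigma> by (simp add: c_def power_divide sum_distrib_left)
  have 1: "real CARD('n) * (norm_n (orth_proj (S_sp X k t) y))\<^sup>2 = \<sigma>\<^sup>2 * (\<Sum>i\<in>I. (c y i)\<^sup>2)" for y
    unfolding norm_n_sq S norm_orth_proj_orthonormal[OF e] sq by simp
  have 2: "real CARD('n) * (norm_n (orth_proj (orthogonal_comp (VS_sp X k t)) y))\<^sup>2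
      = \<sigma>\<^sup>2 * (\<Sum>i\<in>J. (c y i)\<^sup>2)" for y
    unfolding norm_n_sq W norm_orth_proj_orthonormal[OF e] sq by simp
  have 3: "F_stat X k t y
      = ((\<Sum>i\<in>I. (c y i)\<^sup>2) / D_df t) / ((\<Sum>i\<in>J. (c y i)\<^sup>2) / N_df CARD('n) k t)" for y
  proof -
    have sub: "subspace (VS_sp X k t)" by (simp add: VS_sp_eq)
    have n: "(norm_n (orth_proj (S_sp X k t) y))\<^sup>2 = \<sigma>\<^sup>2 * (\<Sum>i\<in>I. (c y i)\<^sup>2) / real CARD('n)"
      "(norm_n (y - orth_proj (VS_sp X k t) y))\<^sup>2 = \<sigma>\<^sup>2 * (\<Sum>i\<in>J. (c y i)\<^sup>2) / real CARD('n)"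
      using 1[of y] 2[of y]
      by (simp_all add: eq_divide_eq mult.commute flip: orth_proj_orthogonal_comp[OF sub])
    show ?thesis unfolding F_stat_def n using \<sigma> by simp
  qed
  have mc: "(\<lambda>y. c y i) \<in> borel_measurable borel" for i
    unfolding c_def by measurable
  have m: "(\<lambda>\<omega>. c (\<epsilon> \<omega>)) \<in> measurable M (PiM UNIV (\<lambda>_. std_gauss))"
    by (rule measurable_PiM_single')
      (use measurable_compose[OF measurable_noise mc] in \<open>auto simp: measurable_cong_sets[OF refl sets_std_gauss]\<close>)
  show thesis
    by (rule that[of c I J])
      (use IJ 1 2 3 m mc distr_orthonormal_coordinates[OF \<sigma> noise e] in
        \<open>auto simp: c_def[abs_def] inner_add_right add_divide_distrib D_df_def N_df_def\<close>)
qed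

lemma measurable_F_stat:
  assumes "k + 2 ^ t \<le> p" shows "F_stat X k t \<in> borel_measurable borel"
proof -
  obtain c :: "real ^ 'n \<Rightarrow> 'n \<Rightarrow> real" and I J where
    F: "\<And>y. F_stat X k t y
      = ((\<Sum>i\<in>I. (c y i)\<^sup>2) / D_df t) / ((\<Sum>i\<in>J. (c y i)\<^sup>2) / N_df CARD('n) k t)"
    and [measurable]: "\<And>i. (\<lambda>y. c y i) \<in> borel_measurable borel"
    using test_coordinates[OF assms] by metis
  show ?thesis unfolding F[abs_def] by measurable
qed

lemma prob_F_stat_gt:
  assumes "k + 2 ^ t \<le> p"
  shows "prob {\<omega> \<in> space M. u < F_stat X k t (\<epsilon> \<omega>)} = Fbar (D_df t) (N_df CARD('n) k t) u"
proof -
  obtain c :: "real ^ 'n \<Rightarrow> 'n \<Rightarrow> real" and I J where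
    IJ: "I \<inter> J = {}" "card I = D_df t" "card J = N_df CARD('n) k t"
    and F: "\<And>y. F_stat X k t y
      = ((\<Sum>i\<in>I. (c y i)\<^sup>2) / D_df t) / ((\<Sum>i\<in>J. (c y i)\<^sup>2) / N_df CARD('n) k t)"
    and m: "(\<lambda>\<omega>. c (\<epsilon> \<omega>)) \<in> measurable M (PiM UNIV (\<lambda>_. std_gauss))"
    and d: "distr M (PiM UNIV (\<lambda>_. std_gauss)) (\<lambda>\<omega>. c (\<epsilon> \<omega>)) = PiM UNIV (\<lambda>_. std_gauss)"
    using test_coordinates[OF assms] by metis
  let ?P = "PiM (UNIV :: 'n set) (\<lambda>_. std_gauss)"
  let ?E = "{z \<in> space ?P. u < ((\<Sum>i\<in>I. (z i)\<^sup>2) / card I) / ((\<Sum>i\<in>J. (z i)\<^sup>2) / card J)}"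
  have [measurable]: "(\<lambda>z. \<Sum>i\<in>I. (z i)\<^sup>2 :: real) \<in> borel_measurable ?P"
    "(\<lambda>z. \<Sum>i\<in>J. (z i)\<^sup>2 :: real) \<in> borel_measurable ?P"
    by (auto intro: measurable_sum_squares)
  have "Fbar (card I) (card J) u = measure ?P ?E"
    by (rule fisher_tail[symmetric]) (use IJ in auto)
  also have "\<dots> = measure (distr M ?P (\<lambda>\<omega>. c (\<epsilon> \<omega>))) ?E" by (simp only: d)
  also have "\<dots> = prob ((\<lambda>\<omega>. c (\<epsilon> \<omega>)) -` ?E \<inter> space M)"
    by (rule measure_distr[OF m]) measurable
  also have "(\<lambda>\<omega>. c (\<epsilon> \<omega>)) -` ?E \<inter> space M = {\<omega> \<in> space M. u < F_stat X k t (\<epsilon> \<omega>)}"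
    using measurable_space[OF m] by (auto simp: F IJ)
  finally show ?thesis by (simp add: IJ)
qed

text \<open>A mean in \<open>V_sp X k\<close> is orthogonal to \<open>S_sp X k t\<close> and
  contained in \<open>VS_sp X k t\<close>, so its coordinates in I and in J vanish.\<close>

lemma F_stat_shift:
  assumes kt: "k + 2 ^ t \<le> p" and \<mu>: "\<mu> \<in> V_sp X k"
  shows "F_stat X k t (\<mu> + y) = F_stat X k t y"
proof -
  obtain c :: "real ^ 'n \<Rightarrow> 'n \<Rightarrow> real" and I J where
    add: "\<And>y z i. c (y + z) i = c y i + c z i"
    and S: "\<And>y. real CARD('n) * (norm_n (orth_proj (S_sp X k t) y))\<^sup>2 = \<sigma>\<^sup>2 * (\<Sum>i\<in>I. (c y i)\<^sup>2)"
    and W: "\<And>y. real CARD('n) * (norm_n (orth_proj (orthogonal_comp (VS_sp X k t)) y))\<^sup>2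
      = \<sigma>\<^sup>2 * (\<Sum>i\<in>J. (c y i)\<^sup>2)"
    and F: "\<And>y. F_stat X k t y
      = ((\<Sum>i\<in>I. (c y i)\<^sup>2) / D_df t) / ((\<Sum>i\<in>J. (c y i)\<^sup>2) / N_df CARD('n) k t)"
    using test_coordinates[OF kt] by metis
  have "\<mu> \<in> VS_sp X k t"
    using \<mu> span_mono[of "X ` {1..k}" "X ` {1..k + 2 ^ t}"] unfolding VS_sp_eq V_sp_def
    by (meson atLeastatMost_subset_iff image_mono le_add1 order_refl subsetD)
  then have "orth_proj (VS_sp X k t) \<mu> = \<mu>"
    by (intro orth_proj_eqI) (auto simp: VS_sp_eq orthogonal_comp_def orthogonal_def)
  then have "orth_proj (orthogonal_comp (VS_sp X k t)) \<mu> = 0"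
    by (subst orth_proj_orthogonal_comp) (auto simp: VS_sp_eq)
  then have J: "c \<mu> i = 0" if "i \<in> J" for i
    using W[of \<mu>] that \<sigma> by (simp add: norm_n_sq sum_nonneg_eq_0_iff)
  have "\<mu> \<in> orthogonal_comp (S_sp X k t)"
    using \<mu> S_sp_orthogonal[of X k t] by (auto simp: orthogonal_comp_def orthogonal_commute)
  then have "orth_proj (S_sp X k t) \<mu> = 0"
    by (intro orth_proj_eqI) (auto simp: S_sp_def span_zero)
  then have I: "c \<mu> i = 0" if "i \<in> I" for i
    using S[of \<mu>] that \<sigma> by (simp add: norm_n_sq sum_nonneg_eq_0_iff)
  show ?thesis unfolding F add using I J by simp
qed

lemma power_bound_test:
  assumes kt: "k + 2 ^ t \<le> p" and a: "0 < a" "a < 1" and y: "0 \<le> y"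
    and D: "D = D_df t" and N: "N = N_df CARD('n) k t"
    and x: "x = ln (1 / a) / N" and d: "d = real D / real N"
    and signal: "2.5 * (1 + 2 * exp (4 * x)) * (d + x)
          * (norm_n (orth_proj (orthogonal_comp (VS_sp X k t)) \<mu>))\<^sup>2
        + \<sigma>\<^sup>2 / real CARD('n) * (N * (2.5 * sqrt 2 * (1 + sqrt d) * sqrt (d * (x + y))
             + 2.5 * max (exp (4 * x)) 5 * (1 + 2 * d) * (x + y)))
      \<le> (norm_n (orth_proj (S_sp X k t) \<mu>))\<^sup>2"
  shows "prob {\<omega> \<in> space M. F_stat X k t (\<mu> + \<epsilon> \<omega>) \<le> Fbar_inv D N a} \<le> exp (- real N * y)"
proof -
  obtain c :: "real ^ 'n \<Rightarrow> 'n \<Rightarrow> real" and I J where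
    add: "\<And>y z i. c (y + z) i = c y i + c z i"
    and IJ: "I \<inter> J = {}" "card I = D" "card J = N"
    and S: "\<And>y. real CARD('n) * (norm_n (orth_proj (S_sp X k t) y))\<^sup>2 = \<sigma>\<^sup>2 * (\<Sum>i\<in>I. (c y i)\<^sup>2)"
    and W: "\<And>y. real CARD('n) * (norm_n (orth_proj (orthogonal_comp (VS_sp X k t)) y))\<^sup>2
      = \<sigma>\<^sup>2 * (\<Sum>i\<in>J. (c y i)\<^sup>2)"
    and F: "\<And>y. F_stat X k t y
      = ((\<Sum>i\<in>I. (c y i)\<^sup>2) / D) / ((\<Sum>i\<in>J. (c y i)\<^sup>2) / N)"
    and m: "(\<lambda>\<omega>. c (\<epsilon> \<omega>)) \<in> measurable M (PiM UNIV (\<lambda>_. std_gauss))"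
    and dist: "distr M (PiM UNIV (\<lambda>_. std_gauss)) (\<lambda>\<omega>. c (\<epsilon> \<omega>)) = PiM UNIV (\<lambda>_. std_gauss)"
    using test_coordinates[OF kt] unfolding D N by metis
  let ?P = "PiM (UNIV :: 'n set) (\<lambda>_. std_gauss)"
  define A where "A = (\<lambda>z :: 'n \<Rightarrow> real. \<Sum>i\<in>I. (c \<mu> i + z i)\<^sup>2)"
  define B where "B = (\<lambda>z :: 'n \<Rightarrow> real. \<Sum>i\<in>J. (c \<mu> i + z i)\<^sup>2)"
  have [measurable]: "A \<in> borel_measurable ?P" "B \<in> borel_measurable ?P"
    using measurable_sum_quadratic[of I UNIV "\<lambda>_. 1" "c \<mu>"] measurable_sum_quadratic[of J UNIV "\<lambda>_. 1" "c \<mu>"]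
    by (simp_all add: A_def B_def)
  let ?E = "{z \<in> space ?P. A z / D / (B z / N) \<le> Fbar_inv D N a}"
  let ?s = "N * (2.5 * sqrt 2 * (1 + sqrt d) * sqrt (d * (x + y))
      + 2.5 * max (exp (4 * x)) 5 * (1 + 2 * d) * (x + y))"
  let ?C = "2.5 * (1 + 2 * exp (4 * x)) * (d + x)"
  have "\<sigma>\<^sup>2 * (?C * (\<Sum>i\<in>J. (c \<mu> i)\<^sup>2) + ?s) \<le> \<sigma>\<^sup>2 * (\<Sum>i\<in>I. (c \<mu> i)\<^sup>2)"
  proof -
    have "real CARD('n) * (?C * (norm_n (orth_proj (orthogonal_comp (VS_sp X k t)) \<mu>))\<^sup>2
        + \<sigma>\<^sup>2 / real CARD('n) * ?s)
      \<le> real CARD('n) * (norm_n (orth_proj (S_sp X k t) \<mu>))\<^sup>2"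
      using signal by (rule mult_left_mono) simp
    moreover have "real CARD('n) * (?C * w + \<sigma>\<^sup>2 / real CARD('n) * ?s)
        = ?C * (real CARD('n) * w) + \<sigma>\<^sup>2 * ?s" for w
      by (simp add: distrib_left)
    moreover have "C * (\<sigma>\<^sup>2 * w) + \<sigma>\<^sup>2 * s = \<sigma>\<^sup>2 * (C * w + s)" for C w s
      by (simp add: algebra_simps)
    ultimately show ?thesis by (simp only: S W)
  qed
  then have sig: "?C * (\<Sum>i\<in>J. (c \<mu> i)\<^sup>2) + ?s \<le> (\<Sum>i\<in>I. (c \<mu> i)\<^sup>2)"
    using \<sigma> by simp
  have "prob {\<omega> \<in> space M. F_stat X k t (\<mu> + \<epsilon> \<omega>) \<le> Fbar_inv D N a}
      = prob ((\<lambda>\<omega>. c (\<epsilon> \<omega>)) -` ?E \<inter> space M)"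
    using measurable_space[OF m] by (intro arg_cong[of _ _ prob]) (auto simp: F add A_def B_def)
  also have "\<dots> = measure (distr M ?P (\<lambda>\<omega>. c (\<epsilon> \<omega>))) ?E"
    by (rule measure_distr[OF m, symmetric]) measurable
  also have "\<dots> = measure ?P ?E" by (simp only: dist)
  also have "\<dots> \<le> exp (- real N * y)"
    unfolding A_def B_def
    by (rule noncentral_test_bound[OF _ _ _ IJ(1,2) _ IJ(3) _ a y x d])
      (use sig D_df_pos N_df_pos[OF kt] in \<open>auto simp: D N\<close>)
  finally show ?thesis .
qed

end

section \<open>The selected index\<close>

lemma T_stat_pos_iff:
  "0 < T_stat X p a k (y :: real ^ 'n) \<longleftrightarrow>
    (\<exists>t\<in>T_set p k. Fbar_inv (D_df t) (N_df CARD('n) k t) (a k t) < F_stat X k t y)"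
  unfolding T_stat_def using T_set_finite[of p k] by (subst less_cSUP_iff) auto

text \<open>\<open>k_hat\<close> never exceeds p, so the test at k0 is among those performed; had it
  accepted, the infimum would be at most k0.\<close>

lemma k_hat_greaterD:
  assumes "k0 < k_hat X p a y" "1 \<le> k0" "k0 \<le> p"
  shows "k0 < p" "0 < T_stat X p a k0 y"
proof -
  let ?K = "{k. 1 \<le> k \<and> k < p \<and> T_stat X p a k y \<le> 0}"
  have le: "k_hat X p a y \<le> p"
  proof (cases "?K = {}")
    case True
    then show ?thesis by (auto simp: k_hat_def not_le)
  next
    case False
    then have "Inf ?K \<in> ?K" by (rule Inf_nat_def1)
    then show ?thesis by (auto simp: k_hat_def)
  qed
  with assms show k0p: "k0 < p" by simp
  show "0 < T_stat X p a k0 y"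
  proof (rule ccontr)
    assume neg: "\<not> 0 < T_stat X p a k0 y"
    then have "k0 \<in> ?K" using assms k0p by auto
    then have "Inf ?K \<le> k0" by (rule cInf_lower) simp
    moreover have "k_hat X p a y = Inf ?K" using neg assms k0p unfolding k_hat_def by auto
    ultimately show False using assms by simp
  qed
qed

text \<open>A value below k0 \<le> p rules out the default p; the infimum is then over a nonempty
  set of naturals, hence attained.\<close>

lemma k_hat_lessD:
  assumes "k_hat X p a y < k0" "k0 \<le> p"
  shows "\<exists>k\<in>{1..<k0}. T_stat X p a k y \<le> 0"
proof -
  let ?K = "{k. 1 \<le> k \<and> k < p \<and> T_stat X p a k y \<le> 0}"
  have "\<not> (\<forall>k. 1 \<le> k \<and> k < p \<longrightarrow> 0 < T_stat X p a k y)"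
  proof
    assume "\<forall>k. 1 \<le> k \<and> k < p \<longrightarrow> 0 < T_stat X p a k y"
    then have "k_hat X p a y = p" unfolding k_hat_def by (rule if_P)
    then show False using assms by simp
  qed
  then have "?K \<noteq> {}" "k_hat X p a y = Inf ?K" by (auto simp: k_hat_def not_less)
  then have "k_hat X p a y \<in> ?K" using Inf_nat_def1[of ?K] by simp
  then show ?thesis using assms by (intro bexI[of _ "k_hat X p a y"]) auto
qed

text \<open>The strict inequality makes this true for every law of Z, with or without atoms: the
  event is the increasing union of {Z \<le> q - 1 / (n + 1)}, with q the quantile, and these
  thresholds lie below the infimum defining q.\<close>

lemma (in prob_space) prob_less_quantile:
  assumes [measurable]: "Z \<in> borel_measurable M" and nonneg: "\<And>\<omega>. \<omega> \<in> space M \<Longrightarrow> 0 \<le> Z \<omega>"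
    and \<alpha>: "0 < \<alpha>"
  shows "prob {\<omega> \<in> space M. Z \<omega> < quantile M Z \<alpha>} \<le> \<alpha>"
proof -
  let ?Q = "{x. \<alpha> \<le> prob {\<omega> \<in> space M. Z \<omega> \<le> x}}"
  define A where "A n = {\<omega> \<in> space M. Z \<omega> \<le> quantile M Z \<alpha> - 1 / real (Suc n)}" for n
  \<comment> \<open>A real infimum is a lower bound only for sets bounded below; nonnegativity of Z
    and \<alpha> > 0 exclude negative thresholds.\<close>
  have bdd: "bdd_below ?Q"
  proof (rule bdd_belowI)
    fix x assume x: "x \<in> ?Q"
    show "0 \<le> x"
    proof (rule ccontr)
      assume "\<not> 0 \<le> x"
      then have empty: "{\<omega> \<in> space M. Z \<omega> \<le> x} = {}" using nonneg by (auto intro: order_trans)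
      show False using x \<alpha> unfolding mem_Collect_eq empty by simp
    qed
  qed
  have le: "prob (A n) \<le> \<alpha>" for n
  proof (rule ccontr)
    assume "\<not> prob (A n) \<le> \<alpha>"
    then have "quantile M Z \<alpha> - 1 / real (Suc n) \<in> ?Q" by (simp add: A_def)
    then have "Inf ?Q \<le> quantile M Z \<alpha> - 1 / real (Suc n)" using bdd by (rule cInf_lower)
    then show False by (simp add: quantile_def)
  qed
  have A: "range A \<subseteq> events" by (auto simp: A_def)
  have mono: "incseq A"
  proof (rule monoI)
    fix m n :: nat assume "m \<le> n"
    then have "1 / real (Suc n) \<le> 1 / real (Suc m)" by (simp add: frac_le)
    then show "A m \<subseteq> A n" by (auto simp: A_def)
  qed
  have "(\<Union>n. A n) = {\<omega> \<in> space M. Z \<omega> < quantile M Z \<alpha>}"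
  proof (intro equalityI subsetI)
    fix \<omega> assume "\<omega> \<in> (\<Union>n. A n)"
    then obtain n where "\<omega> \<in> space M" "Z \<omega> \<le> quantile M Z \<alpha> - 1 / real (Suc n)" by (auto simp: A_def)
    moreover have "0 < 1 / real (Suc n)" by simp
    ultimately show "\<omega> \<in> {\<omega> \<in> space M. Z \<omega> < quantile M Z \<alpha>}" by (auto intro: le_less_trans)
  next
    fix \<omega> assume \<omega>: "\<omega> \<in> {\<omega> \<in> space M. Z \<omega> < quantile M Z \<alpha>}"
    then obtain n where "inverse (real (Suc n)) < quantile M Z \<alpha> - Z \<omega>"
      using reals_Archimedean[of "quantile M Z \<alpha> - Z \<omega>"] by auto
    then have "\<omega> \<in> A n" using \<omega> by (simp add: A_def inverse_eq_divide)
    then show "\<omega> \<in> (\<Union>n. A n)" by blast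
  qed
  then have "(\<lambda>n. prob (A n)) \<longlonglongrightarrow> prob {\<omega> \<in> space M. Z \<omega> < quantile M Z \<alpha>}"
    using finite_Lim_measure_incseq[OF A mono] by simp
  then show ?thesis using le by (intro LIMSEQ_le_const2) auto
qed

section \<open>Error probabilities of the individual tests\<close>

context gaussian_design
begin

lemma measurable_F_stat_noise [measurable (raw)]:
  assumes "k + 2 ^ t \<le> p" shows "(\<lambda>\<omega>. F_stat X k t (\<mu> + \<epsilon> \<omega>)) \<in> borel_measurable M"
  using measurable_compose[OF _ measurable_F_stat[OF assms]] measurable_noise by measurable

text \<open>For P2 this is the union bound, each test having exact level \<open>a k t\<close>. For
  P1 a rejection at t puts the tail probability of the statistic strictly below the common level,
  hence also the infimum Z below its \<alpha>-quantile.\<close>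

lemma level_le:
  assumes k: "k < p"
    and a: "\<And>t. t \<in> T_set p k \<Longrightarrow> 0 < a k t \<and> a k t < 1"
    and \<alpha>: "0 < \<alpha>"
    and proc: "procedure_P1 M \<epsilon> X p \<alpha> a k \<or> procedure_P2 p \<alpha> a k"
  shows "prob {\<omega> \<in> space M. \<exists>t\<in>T_set p k.
    Fbar_inv (D_df t) (N_df CARD('n) k t) (a k t) < F_stat X k t (\<epsilon> \<omega>)} \<le> \<alpha>"
proof -
  let ?n = "CARD('n)"
  let ?D = "\<lambda>t. D_df t" and ?N = "\<lambda>t. N_df ?n k t"
  let ?B = "\<lambda>t. {\<omega> \<in> space M. Fbar_inv (?D t) (?N t) (a k t) < F_stat X k t (\<epsilon> \<omega>)}"
  have kt: "k + 2 ^ t \<le> p" if "t \<in> T_set p k" for t using T_set_le[OF that k] .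
  have mF: "(\<lambda>\<omega>. F_stat X k t (\<epsilon> \<omega>)) \<in> borel_measurable M" if "t \<in> T_set p k" for t
    using measurable_F_stat_noise[OF kt[OF that], of 0] by simp
  have DN: "0 < ?D t" "0 < ?N t" if "t \<in> T_set p k" for t
    using D_df_pos N_df_pos[OF kt[OF that]] .
  have inv: "0 \<le> Fbar_inv (?D t) (?N t) (a k t)" "Fbar (?D t) (?N t) (Fbar_inv (?D t) (?N t) (a k t)) = a k t"
    if "t \<in> T_set p k" for t
    using Fbar_inv_nonneg[OF DN[OF that]] Fbar_Fbar_inv[OF DN[OF that]] a[OF that] by auto
  show ?thesis using proc
  proof
    assume P2: "procedure_P2 p \<alpha> a k"
    have "{\<omega> \<in> space M. \<exists>t\<in>T_set p k. Fbar_inv (?D t) (?N t) (a k t) < F_stat X k t (\<epsilon> \<omega>)}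
        = (\<Union>t\<in>T_set p k. ?B t)" by auto
    moreover have "prob (\<Union>t\<in>T_set p k. ?B t) \<le> (\<Sum>t\<in>T_set p k. prob (?B t))"
    proof (rule finite_measure_subadditive_finite)
      show "?B ` T_set p k \<subseteq> events" using mF by auto
    qed (rule T_set_finite)
    moreover have "(\<Sum>t\<in>T_set p k. prob (?B t)) = (\<Sum>t\<in>T_set p k. a k t)"
      using kt inv by (intro sum.cong) (auto simp: prob_F_stat_gt)
    ultimately show ?thesis using P2 by (simp add: procedure_P2_def)
  next
    assume P1: "procedure_P1 M \<epsilon> X p \<alpha> a k"
    define Z where "Z \<omega> = (INF s\<in>T_set p k. Fbar (?D s) (?N s) (F_stat X k s (\<epsilon> \<omega>)))" for \<omega>
    have bdd: "bdd_below ((\<lambda>s. Fbar (?D s) (?N s) (F_stat X k s (\<epsilon> \<omega>))) ` T_set p k)" for \<omega>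
      using T_set_finite by simp
    have mZ: "Z \<in> borel_measurable M"
      unfolding Z_def
      by (intro borel_measurable_cINF_real countable_finite T_set_finite
          measurable_compose[OF mF measurable_Fbar])
    have "0 \<le> Z \<omega>" for \<omega>
      unfolding Z_def using T_set_finite by (intro cINF_greatest Fbar_nonneg)
    then have le: "prob {\<omega> \<in> space M. Z \<omega> < quantile M Z \<alpha>} \<le> \<alpha>"
      using mZ \<alpha> by (intro prob_less_quantile) auto
    have q: "a k t = quantile M Z \<alpha>" if "t \<in> T_set p k" for t
      using P1 that by (simp add: procedure_P1_def Z_def[abs_def])
    have "{\<omega> \<in> space M. \<exists>t\<in>T_set p k. Fbar_inv (?D t) (?N t) (a k t) < F_stat X k t (\<epsilon> \<omega>)}
        \<subseteq> {\<omega> \<in> space M. Z \<omega> < quantile M Z \<alpha>}"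
    proof (intro subsetI CollectI; elim CollectE conjE bexE; intro conjI; assumption?)
      fix \<omega> t assume t: "t \<in> T_set p k"
        and F: "Fbar_inv (?D t) (?N t) (a k t) < F_stat X k t (\<epsilon> \<omega>)"
      have "Z \<omega> \<le> Fbar (?D t) (?N t) (F_stat X k t (\<epsilon> \<omega>))"
        unfolding Z_def using bdd t by (rule cINF_lower)
      also have "\<dots> < a k t"
        using Fbar_strict_antimono[OF DN[OF t] inv(1)[OF t] F] inv(2)[OF t] by simp
      finally show "Z \<omega> < quantile M Z \<alpha>" using q[OF t] by simp
    qed
    then have "prob {\<omega> \<in> space M. \<exists>t\<in>T_set p k. Fbar_inv (?D t) (?N t) (a k t) < F_stat X k t (\<epsilon> \<omega>)}
        \<le> prob {\<omega> \<in> space M. Z \<omega> < quantile M Z \<alpha>}"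
      using mZ by (intro finite_measure_mono) auto
    then show ?thesis using le by simp
  qed
qed

text \<open>The constants of the theorem are compared with those of the scalar inequality through
  \<open>m_const\<close> = 2 exp (4 x) and K \<ge> 1: these give max (K, m) \<ge> 2 exp (4 x) in
  \<open>C1\<close>, sqrt 2 \<le> sqrt (1 + K^2) in \<open>C2\<close> and m K / 2 \<ge> exp (4 x) in
  \<open>C3\<close>.\<close>

lemma missed_detection_le:
  assumes k: "k < p" and t: "t \<in> T_set p k" and a: "0 < a k t" "a k t < 1"
    and \<gamma>: "0 < \<gamma>" "\<gamma> < 1" and k0: "1 \<le> k0"
    and signal: "(norm_n (orth_proj (S_sp X k t) \<mu>))\<^sup>2
      \<ge> C1 CARD('n) a k t * (norm_n (orth_proj (orthogonal_comp (VS_sp X k t)) \<mu>))\<^sup>2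
        + \<sigma>\<^sup>2 / real CARD('n) *
          (C2 CARD('n) a \<gamma> k t * sqrt (2 ^ t * ln (2 * real k0 / (a k t * \<gamma>)))
           + C3 CARD('n) a \<gamma> k t * ln (2 * real k0 / (a k t * \<gamma>)))"
  shows "prob {\<omega> \<in> space M. F_stat X k t (\<mu> + \<epsilon> \<omega>)
    \<le> Fbar_inv (D_df t) (N_df CARD('n) k t) (a k t)} \<le> \<gamma> / k0"
proof -
  have kt: "k + 2 ^ t \<le> p" using T_set_le[OF t k] .
  define D where "D = D_df t"
  define N where "N = N_df CARD('n) k t"
  define x where "x = ln (1 / a k t) / real N"
  define d where "d = real D / real N"
  define y where "y = ln (2 * real k0 / \<gamma>) / real N"
  define \<Lambda> where "\<Lambda> = ln (2 * real k0 / (a k t * \<gamma>))"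
  define m where "m = m_const CARD('n) a k t"
  define K where "K = K_const CARD('n) a k t (L_of \<gamma>)"
  have D: "0 < D" and N: "0 < N" using D_df_pos N_df_pos[OF kt] by (auto simp: D_def N_def)
  have x0: "0 < x" using a N by (simp add: x_def)
  have d0: "0 < d" using D N by (simp add: d_def)
  have "1 < 2 * real k0 / \<gamma>" using \<gamma> k0 by (simp add: less_divide_eq)
  then have y0: "0 < y" using N by (simp add: y_def)
  \<comment> \<open>The logarithm in the signal condition splits into the contribution N x of the
    level and N y of the target probability.\<close>
  have \<Lambda>: "\<Lambda> = N * (x + y)"
    using a \<gamma> k0 N by (simp add: \<Lambda>_def x_def y_def ln_div ln_mult field_simps)
  have m: "m = 2 * exp (4 * x)" by (simp add: m_def m_const_def Lt_def x_def N_def)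
  have "0 \<le> L_of \<gamma>" using \<gamma> by (simp add: L_of_def)
  then have K: "1 \<le> K" using m by (simp add: K_def K_const_def flip: m_def)
  have C1: "2.5 * (1 + 2 * exp (4 * x)) * (d + x) \<le> C1 CARD('n) a k t"
  proof -
    have "(real (D_df t) + Lt a k t) / real (N_df CARD('n) k t) = d + x"
      by (simp add: d_def x_def D_def N_def Lt_def add_divide_distrib)
    moreover have "m \<le> max (K_const CARD('n) a k t (Lt a k t)) m" by simp
    ultimately show ?thesis
      unfolding C1_def m_def[symmetric] using d0 x0 m by (auto intro!: mult_right_mono)
  qed
  have "real N * (2.5 * sqrt 2 * (1 + sqrt d) * sqrt (d * (x + y))) \<le> C2 CARD('n) a \<gamma> k t * sqrt (2 ^ t * \<Lambda>)"
  proof -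
    have "2 ^ t * \<Lambda> = (real N)\<^sup>2 * (d * (x + y))"
      using N by (simp add: \<Lambda> d_def D_def D_df_def power2_eq_square)
    then have "sqrt (2 ^ t * \<Lambda>) = real N * sqrt (d * (x + y))"
      by (simp add: real_sqrt_mult)
    moreover have "sqrt 2 \<le> sqrt (1 + K\<^sup>2)" using K by simp
    then have "2.5 * sqrt 2 * (1 + sqrt d) \<le> C2 CARD('n) a \<gamma> k t"
      unfolding C2_def K_def[symmetric] N_def[symmetric] D_def[symmetric] d_def[symmetric]
      using d0 by (intro mult_right_mono) auto
    then have "2.5 * sqrt 2 * (1 + sqrt d) * (real N * sqrt (d * (x + y)))
        \<le> C2 CARD('n) a \<gamma> k t * (real N * sqrt (d * (x + y)))"
      using d0 x0 y0 by (intro mult_right_mono) auto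
    ultimately show ?thesis by (simp add: mult_ac)
  qed
  moreover have "real N * (2.5 * max (exp (4 * x)) 5 * (1 + 2 * d) * (x + y)) \<le> C3 CARD('n) a \<gamma> k t * \<Lambda>"
  proof -
    have "exp (4 * x) * 1 \<le> exp (4 * x) * K" using K by (intro mult_left_mono) auto
    then have "max (exp (4 * x)) 5 \<le> max (m * K / 2) 5"
      using m by (intro max.mono) auto
    then have "2.5 * max (exp (4 * x)) 5 * (1 + 2 * d) \<le> C3 CARD('n) a \<gamma> k t"
      unfolding C3_def K_def[symmetric] N_def[symmetric] D_def[symmetric] d_def[symmetric] m_def[symmetric]
      using d0 by (intro mult_right_mono) auto
    then have "2.5 * max (exp (4 * x)) 5 * (1 + 2 * d) * \<Lambda> \<le> C3 CARD('n) a \<gamma> k t * \<Lambda>"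
      using x0 y0 by (intro mult_right_mono) (auto simp: \<Lambda>)
    then show ?thesis by (simp add: \<Lambda> mult_ac)
  qed
  ultimately have noise_le: "real N * (2.5 * sqrt 2 * (1 + sqrt d) * sqrt (d * (x + y))
        + 2.5 * max (exp (4 * x)) 5 * (1 + 2 * d) * (x + y))
      \<le> C2 CARD('n) a \<gamma> k t * sqrt (2 ^ t * \<Lambda>) + C3 CARD('n) a \<gamma> k t * \<Lambda>"
    by (simp only: distrib_left add_mono)
  have "prob {\<omega> \<in> space M. F_stat X k t (\<mu> + \<epsilon> \<omega>) \<le> Fbar_inv D N (a k t)} \<le> exp (- real N * y)"
  proof (rule power_bound_test[OF kt a less_imp_le[OF y0] D_def N_def x_def d_def])
    show "2.5 * (1 + 2 * exp (4 * x)) * (d + x)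
          * (norm_n (orth_proj (orthogonal_comp (VS_sp X k t)) \<mu>))\<^sup>2
        + \<sigma>\<^sup>2 / real CARD('n) * (N * (2.5 * sqrt 2 * (1 + sqrt d) * sqrt (d * (x + y))
             + 2.5 * max (exp (4 * x)) 5 * (1 + 2 * d) * (x + y)))
      \<le> (norm_n (orth_proj (S_sp X k t) \<mu>))\<^sup>2"
      using signal unfolding \<Lambda>_def[symmetric]
      by (rule order_trans[rotated]) (intro add_mono mult_right_mono mult_left_mono C1 noise_le; simp)
  qed
  also have "exp (- real N * y) = \<gamma> / (2 * k0)"
    using N \<gamma> k0 by (simp add: y_def exp_minus ln_div exp_diff exp_ln_iff)
  also have "\<dots> \<le> \<gamma> / k0" using \<gamma> k0 by (simp add: field_simps)
  finally show ?thesis by (simp add: D_def N_def)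
qed

end

theorem theorem2p1:
  fixes M :: "'a measure"
    and \<epsilon> Y :: "'a \<Rightarrow> real ^ 'n"
    and X :: "nat \<Rightarrow> real ^ 'n"
    and \<beta> :: "nat \<Rightarrow> real"
    and \<mu> :: "real ^ 'n"
    and p k0 :: nat
    and \<sigma> \<alpha> \<gamma> :: real
    and a :: "nat \<Rightarrow> nat \<Rightarrow> real"
  assumes "prob_space M"
    and "\<sigma> > 0"
    and "distributed M lborel \<epsilon> (\<lambda>x. ennreal (iso_normal_density \<sigma> x))"
    and "p < CARD('n)"
    and "X 1 = (\<chi> i. 1 / sqrt (real CARD('n)))"
    and "\<forall>i. 2 \<le> i \<and> i \<le> p \<longrightarrow> norm_n (X i) = 1"
    and "inj_on X {1..p}" and "independent (X ` {1..p})"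
    and "\<mu> = (\<Sum>i = 1..p. \<beta> i *\<^sub>R X i)"
    and "\<forall>\<omega>\<in>space M. Y \<omega> = \<mu> + \<epsilon> \<omega>"
    and "1 \<le> k0" and "k0 \<le> p"
    and "{j \<in> {1..p}. \<beta> j \<noteq> 0} = {1..k0}"
    and "0 < \<alpha>" "\<alpha> < 1" and "0 < \<gamma>" "\<gamma> < 1"
    and "\<forall>k. 1 \<le> k \<and> k < p \<longrightarrow> (\<forall>t\<in>T_set p k. 0 < a k t \<and> a k t < 1)"
    and "\<forall>k. 1 \<le> k \<and> k < p \<longrightarrow> procedure_P1 M \<epsilon> X p \<alpha> a k \<or> procedure_P2 p \<alpha> a k"
  shows "measure M {\<omega> \<in> space M. k_hat X p a (Y \<omega>) > k0} \<le> \<alpha> \<and>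
    ((\<forall>k. 1 \<le> k \<and> k \<le> k0 - 1 \<longrightarrow>
        (\<exists>t\<in>T_set p k.
          (norm_n (orth_proj (S_sp X k t) \<mu>))\<^sup>2
            \<ge> C1 CARD('n) a k t * (norm_n (orth_proj (orthogonal_comp (VS_sp X k t)) \<mu>))\<^sup>2
              + \<sigma>\<^sup>2 / real CARD('n) *
                (C2 CARD('n) a \<gamma> k t * sqrt (2 ^ t * ln (2 * real k0 / (a k t * \<gamma>)))
                 + C3 CARD('n) a \<gamma> k t * ln (2 * real k0 / (a k t * \<gamma>)))))
      \<longrightarrow> measure M {\<omega> \<in> space M. k_hat X p a (Y \<omega>) < k0} \<le> \<gamma> \<and>
          measure M {\<omega> \<in> space M. k_hat X p a (Y \<omega>) \<noteq> k0} \<le> \<gamma> + \<alpha>)"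
proof -
  interpret gaussian_design M \<epsilon> \<sigma> X p
    using assms by (simp add: gaussian_design_def gaussian_design_axioms_def)
  have Y: "Y \<omega> = \<mu> + \<epsilon> \<omega>" if "\<omega> \<in> space M" for \<omega> using assms(10) that by simp
  have k0: "1 \<le> k0" "k0 \<le> p" and \<alpha>: "0 < \<alpha>" and \<gamma>: "0 < \<gamma>" "\<gamma> < 1" using assms by auto
  have a: "0 < a k t \<and> a k t < 1" if "1 \<le> k" "k < p" "t \<in> T_set p k" for k t
    using assms(18) that by blast
  have \<mu>: "\<mu> \<in> V_sp X k0"
  proof -
    have "\<beta> i = 0" if "i \<in> {1..p}" "i \<notin> {1..k0}" for i using assms(13) that by blast
    then have "\<mu> = (\<Sum>i = 1..k0. \<beta> i *\<^sub>R X i)"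
      unfolding assms(9) using k0 by (intro sum.mono_neutral_right) auto
    also have "\<dots> \<in> V_sp X k0"
      unfolding V_sp_def by (rule span_sum, rule span_scale, rule span_base) auto
    finally show ?thesis .
  qed
  \<comment> \<open>The events on \<open>k_hat\<close> are estimated through inclusion in measurable
    events built from the statistics. The conjunct k0 < p makes this one empty for k0 = p.\<close>
  define over where "over = {\<omega> \<in> space M. k0 < p \<and> (\<exists>t\<in>T_set p k0.
    Fbar_inv (D_df t) (N_df CARD('n) k0 t) (a k0 t) < F_stat X k0 t (\<epsilon> \<omega>))}"
  have over_meas: "over \<in> events"
  proof (cases "k0 < p")
    case True
    have "(\<lambda>\<omega>. F_stat X k0 t (\<epsilon> \<omega>)) \<in> borel_measurable M" if "t \<in> T_set p k0" for t
      using measurable_F_stat_noise[OF T_set_le[OF that True], of 0] by simp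
    then have "{\<omega> \<in> space M. Fbar_inv (D_df t) (N_df CARD('n) k0 t) (a k0 t) < F_stat X k0 t (\<epsilon> \<omega>)} \<in> events"
      if "t \<in> T_set p k0" for t using that by measurable
    then have "(\<Union>t\<in>T_set p k0. {\<omega> \<in> space M. Fbar_inv (D_df t) (N_df CARD('n) k0 t) (a k0 t) < F_stat X k0 t (\<epsilon> \<omega>)}) \<in> events"
      using T_set_finite by (intro sets.finite_UN) auto
    moreover have "over = (\<Union>t\<in>T_set p k0. {\<omega> \<in> space M. Fbar_inv (D_df t) (N_df CARD('n) k0 t) (a k0 t) < F_stat X k0 t (\<epsilon> \<omega>)})"
      using True by (auto simp: over_def)
    ultimately show ?thesis by simp
  qed (simp add: over_def)
  have over_prob: "prob over \<le> \<alpha>"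
  proof (cases "k0 < p")
    case True
    then show ?thesis
      unfolding over_def using level_le[where a = a, OF True a[OF k0(1) True] \<alpha>] assms(19) k0 by simp
  qed (use \<alpha> in \<open>simp add: over_def\<close>)
  have over_sub: "{\<omega> \<in> space M. k_hat X p a (Y \<omega>) > k0} \<subseteq> over"
  proof
    fix \<omega> assume "\<omega> \<in> {\<omega> \<in> space M. k_hat X p a (Y \<omega>) > k0}"
    then have \<omega>: "\<omega> \<in> space M" "k0 < k_hat X p a (Y \<omega>)" by auto
    have kp: "k0 < p" by (rule k_hat_greaterD(1)[OF \<omega>(2) k0])
    have "0 < T_stat X p a k0 (\<mu> + \<epsilon> \<omega>)" using k_hat_greaterD(2)[OF \<omega>(2) k0] Y[OF \<omega>(1)] by simp
    then obtain t where t: "t \<in> T_set p k0"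
      "Fbar_inv (D_df t) (N_df CARD('n) k0 t) (a k0 t) < F_stat X k0 t (\<mu> + \<epsilon> \<omega>)"
      by (auto simp: T_stat_pos_iff)
    then show "\<omega> \<in> over"
      using \<omega> kp F_stat_shift[OF T_set_le[OF t(1) kp] \<mu>] by (auto simp: over_def)
  qed
  have 1: "prob {\<omega> \<in> space M. k_hat X p a (Y \<omega>) > k0} \<le> \<alpha>"
    using finite_measure_mono[OF over_sub over_meas] over_prob by simp
  show ?thesis
  proof (intro conjI 1 impI)
    let ?S = "\<lambda>k t. (norm_n (orth_proj (S_sp X k t) \<mu>))\<^sup>2
            \<ge> C1 CARD('n) a k t * (norm_n (orth_proj (orthogonal_comp (VS_sp X k t)) \<mu>))\<^sup>2
              + \<sigma>\<^sup>2 / real CARD('n) *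
                (C2 CARD('n) a \<gamma> k t * sqrt (2 ^ t * ln (2 * real k0 / (a k t * \<gamma>)))
                 + C3 CARD('n) a \<gamma> k t * ln (2 * real k0 / (a k t * \<gamma>)))"
    assume *: "\<forall>k. 1 \<le> k \<and> k \<le> k0 - 1 \<longrightarrow> (\<exists>t\<in>T_set p k. ?S k t)"
    have "\<forall>k\<in>{1..<k0}. \<exists>t. t \<in> T_set p k \<and> ?S k t"
    proof
      fix k assume "k \<in> {1..<k0}"
      then have "1 \<le> k \<and> k \<le> k0 - 1" by auto
      with * show "\<exists>t. t \<in> T_set p k \<and> ?S k t" by blast
    qed
    from bchoice[OF this] obtain \<tau>
      where \<tau>_all: "\<forall>k\<in>{1..<k0}. \<tau> k \<in> T_set p k \<and> ?S k (\<tau> k)" ..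
    have \<tau>: "\<tau> k \<in> T_set p k" and signal: "?S k (\<tau> k)" if "k \<in> {1..<k0}" for k
      using \<tau>_all that by blast+
    define miss where "miss k = {\<omega> \<in> space M. F_stat X k (\<tau> k) (\<mu> + \<epsilon> \<omega>)
      \<le> Fbar_inv (D_df (\<tau> k)) (N_df CARD('n) k (\<tau> k)) (a k (\<tau> k))}" for k
    have kp: "k < p" if "k \<in> {1..<k0}" for k using that k0 by simp
    have miss_meas: "miss k \<in> events" if "k \<in> {1..<k0}" for k
      using measurable_F_stat_noise[OF T_set_le[OF \<tau>[OF that] kp[OF that]], of \<mu>]
      unfolding miss_def by measurable
    have miss_prob: "prob (miss k) \<le> \<gamma> / k0" if "k \<in> {1..<k0}" for k
      unfolding miss_def
      using missed_detection_le[OF kp[OF that] \<tau>[OF that] _ _ \<gamma> k0(1) signal[OF that]]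
        a[OF _ kp[OF that] \<tau>[OF that]] that by simp
    let ?under = "\<Union>k\<in>{1..<k0}. miss k"
    have under_meas: "?under \<in> events" using miss_meas by (intro sets.finite_UN) auto
    have under_prob: "prob ?under \<le> \<gamma>"
    proof -
      have "prob ?under \<le> (\<Sum>k\<in>{1..<k0}. prob (miss k))"
        using miss_meas by (intro finite_measure_subadditive_finite) auto
      also have "\<dots> \<le> (\<Sum>k\<in>{1..<k0}. \<gamma> / k0)" using miss_prob by (intro sum_mono)
      also have "\<dots> = real (k0 - 1) * (\<gamma> / k0)" by simp
      \<comment> \<open>Only the k0 - 1 tests before k0 contribute, each with at most \<gamma> /
        k0.\<close>
      also have "\<dots> \<le> real k0 * (\<gamma> / k0)" using \<gamma> by (intro mult_right_mono) auto
      finally show ?thesis using k0 by simp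
    qed
    have under_sub: "{\<omega> \<in> space M. k_hat X p a (Y \<omega>) < k0} \<subseteq> ?under"
    proof
      fix \<omega> assume "\<omega> \<in> {\<omega> \<in> space M. k_hat X p a (Y \<omega>) < k0}"
      then have \<omega>: "\<omega> \<in> space M" "k_hat X p a (Y \<omega>) < k0" by auto
      obtain k where k: "k \<in> {1..<k0}" "\<not> 0 < T_stat X p a k (Y \<omega>)"
        using k_hat_lessD[OF \<omega>(2) k0(2)] by (auto simp: not_less)
      then have "\<omega> \<in> miss k"
        using \<omega>(1) \<tau>[OF k(1)] unfolding T_stat_pos_iff Y[OF \<omega>(1)] miss_def by (auto simp: not_less)
      then show "\<omega> \<in> ?under" using k by blast
    qed
    show "prob {\<omega> \<in> space M. k_hat X p a (Y \<omega>) < k0} \<le> \<gamma>"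
      using finite_measure_mono[OF under_sub under_meas] under_prob by simp
    have "{\<omega> \<in> space M. k_hat X p a (Y \<omega>) \<noteq> k0} \<subseteq> ?under \<union> over"
      using under_sub over_sub by (auto simp: neq_iff)
    then have "prob {\<omega> \<in> space M. k_hat X p a (Y \<omega>) \<noteq> k0} \<le> prob (?under \<union> over)"
      using under_meas over_meas by (intro finite_measure_mono) auto
    also have "\<dots> \<le> prob ?under + prob over"
      using under_meas over_meas by (rule measure_Un_le)
    finally show "prob {\<omega> \<in> space M. k_hat X p a (Y \<omega>) \<noteq> k0} \<le> \<gamma> + \<alpha>"
      using under_prob over_prob by simp
  qed
qed

end
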